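(* Let $m\in\mathbb{N}_0$ and $n\in\mathbb{N}$ with $m+1=n$, let $\mu$ be a radial weight on the unit disk $\mathbb{D}$, let $\psi_1,\psi_2$ be analytic functions on $\mathbb{D}$, and let $\varphi:\mathbb{D}\to\mathbb{D}$ be analytic. Define $$(T^{m,n}_{\psi_1,\psi_2,\varphi}f)(z)=\psi_1(z)f^{(m)}(\varphi(z))+\psi_2(z)f^{(n)}(\varphi(z)),\qquad z\in\mathbb{D},$$ and $E_m=\psi_1'$, $E_{n+1}=\psi_2\varphi'$. Suppose that $T^{m,n}_{\psi_1,\psi_2,\varphi}:H^\infty\to\mathcal{B}_\mu$ is bounded. Then $$\|T^{m,n}_{\psi_1,\psi_2,\varphi}\|_{e,H^\infty\to\mathcal{B}_\mu}\approx\max_{i\in\{m,n+1\}}\Big\{\limsup_{|\varphi(z)|\to1}\frac{\mu(z)|E_i(z)|}{(1-|\varphi(z)|^2)^i},\ \limsup_{|\varphi(z)|\to1}\frac{\mu(z)|\psi_1(z)\varphi'(z)+\psi_2'(z)|}{(1-|\varphi(z)|^2)^n}\Big\}$$ $$\approx\max_{1\le i\le3}\Big\{\limsup_{|\varphi(w)|\to1}\|T^{m,n}_{\psi_1,\psi_2,\varphi}f_{i,\varphi(w)}\|_{\mathcal{B}_\mu}\Big\},$$ where $f_{i,\varphi(w)}(z)=\Big(\dfrac{1-|\varphi(w)|}{1-\overline{\varphi(w)}z}\Big)^i$ for $w,z\in\mathbb{D}$.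
   Context: $\mathbb{D}=\{z\in\mathbb{C}:|z|<1\}$, $\mathbb{N}_0=\{0,1,2,\dots\}$, $\mathbb{N}=\{1,2,\dots\}$. $H^\infty$ is the space of bounded analytic functions on $\mathbb{D}$ with norm $\|f\|_\infty=\sup_{z\in\mathbb{D}}|f(z)|$. A radial weight is a positive continuous function $\mu$ on $\mathbb{D}$ with $\mu(z)=\mu(|z|)$. The weighted Bloch space $\mathcal{B}_\mu$ is the space of analytic $f$ on $\mathbb{D}$ with $\|f\|_{\mathcal{B}_\mu}=|f(0)|+\sup_{z\in\mathbb{D}}\mu(z)|f'(z)|<\infty$. Essential norm: for a bounded linear operator $T:X\to Y$, $\|T\|_{e,X\to Y}=\inf\{\|T-L\|_{X\to Y}: L:X\to Y \text{ compact linear}\}$, where $\|S\|_{X\to Y}=\sup_{\|f\|_X\le1}\|Sf\|_Y$. $A\approx B$ means that there is a constant $C>0$ with $C^{-1}B\le A\le CB$; here $C$ does not depend on $\psi_1,\psi_2,\varphi$. The notation $\limsup_{|\varphi(z)|\to1}F(z)$ means $\lim_{\delta\to1^-}\sup\{F(z): z\in\mathbb{D},\ |\varphi(z)|>\delta\}$, interpreted as $0$ if $\sup_{z\in\mathbb{D}}|\varphi(z)|<1$. *)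

theory Defs
  imports "HOL-Complex_Analysis.Complex_Analysis"
begin

abbreviation unit_disc :: "complex set"
  where "unit_disc \<equiv> ball 0 1"

text \<open>
  A function on the disc is represented by the total function that vanishes outside the disc, so
  that equality of representatives is equality on the disc and the spaces below are genuine normed
  spaces. Norms, suprema and limits superior take values in \<^typ>\<open>ennreal\<close>, where they always exist.
\<close>

definition analytic_fun :: "(complex \<Rightarrow> complex) set"
  where "analytic_fun = {f. f holomorphic_on unit_disc \<and> (\<forall>z. z \<notin> unit_disc \<longrightarrow> f z = 0)}"

definition Hinf_norm :: "(complex \<Rightarrow> complex) \<Rightarrow> ennreal"
  where "Hinf_norm f = (SUP z\<in>unit_disc. ennreal (cmod (f z)))"

definition Hinf :: "(complex \<Rightarrow> complex) set"
  where "Hinf = {f \<in> analytic_fun. Hinf_norm f < \<infinity>}"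

definition radial_weight :: "(complex \<Rightarrow> real) \<Rightarrow> bool"
  where "radial_weight \<mu> \<longleftrightarrow> continuous_on unit_disc \<mu> \<and>
    (\<forall>z\<in>unit_disc. 0 < \<mu> z) \<and> (\<forall>z\<in>unit_disc. \<mu> z = \<mu> (of_real (cmod z)))"

definition bloch_norm :: "(complex \<Rightarrow> real) \<Rightarrow> (complex \<Rightarrow> complex) \<Rightarrow> ennreal"
  where "bloch_norm \<mu> f =
    ennreal (cmod (f 0)) + (SUP z\<in>unit_disc. ennreal (\<mu> z * cmod (deriv f z)))"

definition bloch :: "(complex \<Rightarrow> real) \<Rightarrow> (complex \<Rightarrow> complex) set"
  where "bloch \<mu> = {f \<in> analytic_fun. bloch_norm \<mu> f < \<infinity>}"

text \<open>
  Operators between normed function spaces \<open>(X, nX)\<close> and \<open>(Y, nY)\<close>; only the values of an operator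
  on \<open>X\<close> matter.
\<close>

definition linear_op ::
  "(complex \<Rightarrow> complex) set \<Rightarrow> (complex \<Rightarrow> complex) set
    \<Rightarrow> ((complex \<Rightarrow> complex) \<Rightarrow> (complex \<Rightarrow> complex)) \<Rightarrow> bool"
  where "linear_op X Y T \<longleftrightarrow>
    (\<forall>f\<in>X. T f \<in> Y) \<and>
    (\<forall>f\<in>X. \<forall>g\<in>X. T (\<lambda>z. f z + g z) = (\<lambda>z. T f z + T g z)) \<and>
    (\<forall>c. \<forall>f\<in>X. T (\<lambda>z. c * f z) = (\<lambda>z. c * T f z))"

definition op_norm ::
  "(complex \<Rightarrow> complex) set \<Rightarrow> ((complex \<Rightarrow> complex) \<Rightarrow> ennreal) \<Rightarrow> ((complex \<Rightarrow> complex) \<Rightarrow> ennreal)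
    \<Rightarrow> ((complex \<Rightarrow> complex) \<Rightarrow> (complex \<Rightarrow> complex)) \<Rightarrow> ennreal"
  where "op_norm X nX nY S = (SUP f\<in>{f \<in> X. nX f \<le> 1}. nY (S f))"

definition bounded_op ::
  "(complex \<Rightarrow> complex) set \<Rightarrow> ((complex \<Rightarrow> complex) \<Rightarrow> ennreal)
    \<Rightarrow> (complex \<Rightarrow> complex) set \<Rightarrow> ((complex \<Rightarrow> complex) \<Rightarrow> ennreal)
    \<Rightarrow> ((complex \<Rightarrow> complex) \<Rightarrow> (complex \<Rightarrow> complex)) \<Rightarrow> bool"
  where "bounded_op X nX Y nY T \<longleftrightarrow>
    linear_op X Y T \<and> (\<exists>M::real. \<forall>f\<in>X. nY (T f) \<le> ennreal M * nX f)"

definition norm_dist ::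
  "((complex \<Rightarrow> complex) \<Rightarrow> ennreal) \<Rightarrow> (complex \<Rightarrow> complex) \<Rightarrow> (complex \<Rightarrow> complex) \<Rightarrow> real"
  where "norm_dist nY f g = enn2real (nY (\<lambda>z. f z - g z))"

definition compact_op ::
  "(complex \<Rightarrow> complex) set \<Rightarrow> ((complex \<Rightarrow> complex) \<Rightarrow> ennreal)
    \<Rightarrow> (complex \<Rightarrow> complex) set \<Rightarrow> ((complex \<Rightarrow> complex) \<Rightarrow> ennreal)
    \<Rightarrow> ((complex \<Rightarrow> complex) \<Rightarrow> (complex \<Rightarrow> complex)) \<Rightarrow> bool"
  where "compact_op X nX Y nY L \<longleftrightarrow>
    linear_op X Y L \<and>
    (let \<tau> = Metric_space.mtopology Y (norm_dist nY)
     in compactin \<tau> (\<tau> closure_of (L ` {f \<in> X. nX f \<le> 1})))"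

definition ess_norm ::
  "(complex \<Rightarrow> complex) set \<Rightarrow> ((complex \<Rightarrow> complex) \<Rightarrow> ennreal)
    \<Rightarrow> (complex \<Rightarrow> complex) set \<Rightarrow> ((complex \<Rightarrow> complex) \<Rightarrow> ennreal)
    \<Rightarrow> ((complex \<Rightarrow> complex) \<Rightarrow> (complex \<Rightarrow> complex)) \<Rightarrow> ennreal"
  where "ess_norm X nX Y nY T =
    (INF L\<in>{L. compact_op X nX Y nY L}. op_norm X nX nY (\<lambda>f z. T f z - L f z))"

definition T_op ::
  "nat \<Rightarrow> nat \<Rightarrow> (complex \<Rightarrow> complex) \<Rightarrow> (complex \<Rightarrow> complex) \<Rightarrow> (complex \<Rightarrow> complex)
    \<Rightarrow> (complex \<Rightarrow> complex) \<Rightarrow> (complex \<Rightarrow> complex)"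
  where "T_op m n \<psi>\<^sub>1 \<psi>\<^sub>2 \<phi> f = (\<lambda>z. if z \<in> unit_disc
    then \<psi>\<^sub>1 z * (deriv ^^ m) f (\<phi> z) + \<psi>\<^sub>2 z * (deriv ^^ n) f (\<phi> z) else 0)"

text \<open>Only the indices \<open>i = m\<close> and \<open>i = n + 1\<close> are meaningful.\<close>

definition E_fun ::
  "nat \<Rightarrow> nat \<Rightarrow> (complex \<Rightarrow> complex) \<Rightarrow> (complex \<Rightarrow> complex) \<Rightarrow> (complex \<Rightarrow> complex)
    \<Rightarrow> nat \<Rightarrow> complex \<Rightarrow> complex"
  where "E_fun m n \<psi>\<^sub>1 \<psi>\<^sub>2 \<phi> i z =
    (if i = m then deriv \<psi>\<^sub>1 z else if i = n + 1 then \<psi>\<^sub>2 z * deriv \<phi> z else 0)"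

definition test_fun :: "nat \<Rightarrow> complex \<Rightarrow> complex \<Rightarrow> complex"
  where "test_fun i a = (\<lambda>z. if z \<in> unit_disc
    then (of_real (1 - cmod a) / (1 - cnj a * z)) ^ i else 0)"

definition limsup_to_bdry :: "(complex \<Rightarrow> complex) \<Rightarrow> (complex \<Rightarrow> ennreal) \<Rightarrow> ennreal"
  where "limsup_to_bdry \<phi> F =
    (if (SUP z\<in>unit_disc. cmod (\<phi> z)) < 1 then 0
     else Lim (at_left (1::real)) (\<lambda>\<delta>. SUP z\<in>{z \<in> unit_disc. \<delta> < cmod (\<phi> z)}. F z))"

definition comparable :: "real \<Rightarrow> ennreal \<Rightarrow> ennreal \<Rightarrow> bool"
  where "comparable C A B \<longleftrightarrow> ennreal (1 / C) * B \<le> A \<and> A \<le> ennreal C * B"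

text \<open>
  The limit in \<^const>\<open>limsup_to_bdry\<close> exists, and \<^const>\<open>norm_dist\<close> is a metric on the Bloch space,
  as \<^const>\<open>compact_op\<close> requires.
\<close>

lemma limsup_to_bdry_tendsto:
  "((\<lambda>\<delta>. SUP z\<in>{z \<in> unit_disc. \<delta> < cmod (\<phi> z)}. F z :: ennreal) \<longlongrightarrow>
    (INF \<delta>\<in>{..<1::real}. SUP z\<in>{z \<in> unit_disc. \<delta> < cmod (\<phi> z)}. F z)) (at_left 1)"
  (is "(?S \<longlongrightarrow> ?I) _")
proof (rule order_tendstoI)
  fix a assume "a < ?I"
  then have "a < ?S x" if "x < 1" for x
    using that by (meson INF_lower lessThan_iff less_le_trans)
  then show "eventually (\<lambda>x. a < ?S x) (at_left 1)"
    by (auto simp: eventually_at_filter)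
next
  have anti: "?S y \<le> ?S x" if "x \<le> y" for x y
    using that by (intro SUP_subset_mono) auto
  fix a assume "?I < a"
  then obtain x where x: "x < 1" "?S x < a"
    by (auto simp: INF_less_iff)
  then have "?S y < a" if "x < y" for y
    using anti[of x y] that by auto
  with x(1) show "eventually (\<lambda>x. ?S x < a) (at_left 1)"
    by (auto simp: eventually_at_left[OF x(1)])
qed

lemma Metric_space_bloch:
  assumes "radial_weight \<mu>"
  shows "Metric_space (bloch \<mu>) (norm_dist (bloch_norm \<mu>))"
proof
  have D: "deriv (\<lambda>z. f z - g z) z = deriv f z - deriv g z" 
    if "f \<in> bloch \<mu>" "g \<in> bloch \<mu>" "z \<in> unit_disc" for f g z
    using that by (intro deriv_diff holomorphic_on_imp_differentiable_at[of _ unit_disc])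
      (auto simp: bloch_def analytic_fun_def)
  have pos: "0 < \<mu> z" if "z \<in> unit_disc" for z
    using assms that unfolding radial_weight_def by blast
  have tri: "bloch_norm \<mu> (\<lambda>z. f z - h z)
      \<le> bloch_norm \<mu> (\<lambda>z. f z - g z) + bloch_norm \<mu> (\<lambda>z. g z - h z)"
    if fgh: "f \<in> bloch \<mu>" "g \<in> bloch \<mu>" "h \<in> bloch \<mu>" for f g h
  proof -
    have 1: "ennreal (cmod (f 0 - h 0)) \<le> ennreal (cmod (f 0 - g 0)) + ennreal (cmod (g 0 - h 0))"
      using norm_triangle_ineq[of "f 0 - g 0" "g 0 - h 0"]
      by (simp add: ennreal_leI flip: ennreal_plus)
    have 2: "ennreal (\<mu> z * cmod (deriv (\<lambda>z. f z - h z) z)) \<le>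
        (SUP z\<in>unit_disc. ennreal (\<mu> z * cmod (deriv (\<lambda>z. f z - g z) z))) +
        (SUP z\<in>unit_disc. ennreal (\<mu> z * cmod (deriv (\<lambda>z. g z - h z) z)))" if z: "z \<in> unit_disc" for z
    proof -
      have "cmod (deriv f z - deriv h z) \<le> cmod (deriv f z - deriv g z) + cmod (deriv g z - deriv h z)"
        using norm_triangle_ineq[of "deriv f z - deriv g z" "deriv g z - deriv h z"] by simp
      then have "\<mu> z * cmod (deriv (\<lambda>z. f z - h z) z) \<le>
          \<mu> z * cmod (deriv (\<lambda>z. f z - g z) z) + \<mu> z * cmod (deriv (\<lambda>z. g z - h z) z)"
        using pos[OF z] z fgh D by (simp flip: distrib_left)
      then have "ennreal (\<mu> z * cmod (deriv (\<lambda>z. f z - h z) z)) \<le>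
          ennreal (\<mu> z * cmod (deriv (\<lambda>z. f z - g z) z)) + ennreal (\<mu> z * cmod (deriv (\<lambda>z. g z - h z) z))"
        using pos[OF z] by (subst ennreal_plus[symmetric]) (auto simp del: ennreal_plus intro!: ennreal_leI)
      also have "\<dots> \<le> (SUP z\<in>unit_disc. ennreal (\<mu> z * cmod (deriv (\<lambda>z. f z - g z) z))) +
        (SUP z\<in>unit_disc. ennreal (\<mu> z * cmod (deriv (\<lambda>z. g z - h z) z)))"
        using z by (intro add_mono SUP_upper) 
      finally show ?thesis .
    qed
    show ?thesis
      unfolding bloch_norm_def
      by (rule order_trans[OF add_mono[OF 1 SUP_least[OF 2]]]) (auto simp: ac_simps)
  qed
  have zero: "(\<lambda>z. 0) \<in> bloch \<mu>"
    by (auto simp: bloch_def analytic_fun_def bloch_norm_def)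
  have neg_deriv: "cmod (deriv (\<lambda>z. - h z) z) = cmod (deriv h z)" for h :: "complex \<Rightarrow> complex" and z
  proof (cases "h field_differentiable at z")
    case False
    then have "\<not> (\<lambda>z. - h z) field_differentiable at z"
      using field_differentiable_minus[of "\<lambda>z. - h z"] by auto
    with False have "(\<lambda>d. ((\<lambda>z. - h z) has_field_derivative d) (at z)) =
        (\<lambda>d. (h has_field_derivative d) (at z))"
      by (auto simp: field_differentiable_def)
    then show ?thesis
      by (simp add: deriv_def)
  qed simp
  have neg: "bloch_norm \<mu> (\<lambda>z. f z - g z) = bloch_norm \<mu> (\<lambda>z. g z - f z)" for f g
    using neg_deriv[of "\<lambda>z. g z - f z"] by (simp add: bloch_norm_def norm_minus_commute)
  have fin: "bloch_norm \<mu> (\<lambda>z. f z - g z) < \<infinity>"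
    if "f \<in> bloch \<mu>" "g \<in> bloch \<mu>" for f g
    using tri[OF that(1) zero that(2)] neg[of "\<lambda>z. 0" g] that
    by (auto simp: bloch_def intro: le_less_trans)
  show "0 \<le> norm_dist (bloch_norm \<mu>) f g" for f g
    by (simp add: norm_dist_def)
  show "norm_dist (bloch_norm \<mu>) f g = norm_dist (bloch_norm \<mu>) g f" for f g
    unfolding norm_dist_def by (subst neg) (rule refl)
  show "norm_dist (bloch_norm \<mu>) f h
      \<le> norm_dist (bloch_norm \<mu>) f g + norm_dist (bloch_norm \<mu>) g h"
    if "f \<in> bloch \<mu>" "g \<in> bloch \<mu>" "h \<in> bloch \<mu>" for f g h
    using tri[OF that] fin[OF that(1,2)] fin[OF that(2,3)]
    unfolding norm_dist_def
    by (subst enn2real_plus[symmetric]) (auto intro!: enn2real_mono)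
  show "norm_dist (bloch_norm \<mu>) f g = 0 \<longleftrightarrow> f = g"
    if fg: "f \<in> bloch \<mu>" "g \<in> bloch \<mu>" for f g
  proof
    assume "norm_dist (bloch_norm \<mu>) f g = 0"
    then have "bloch_norm \<mu> (\<lambda>z. f z - g z) = 0"
      using fin[OF fg] by (auto simp: norm_dist_def enn2real_eq_0_iff)
    then have f0: "f 0 = g 0"
      and "(SUP z\<in>unit_disc. ennreal (\<mu> z * cmod (deriv (\<lambda>z. f z - g z) z))) = 0"
      by (auto simp: bloch_norm_def)
    then have "ennreal (\<mu> z * cmod (deriv (\<lambda>z. f z - g z) z)) = 0" if "z \<in> unit_disc" for z
      using SUP_upper[OF that, of "\<lambda>z. ennreal (\<mu> z * cmod (deriv (\<lambda>z. f z - g z) z))"]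
      by (simp only: le_zero_eq)
    then have d0: "deriv (\<lambda>z. f z - g z) z = 0" if "z \<in> unit_disc" for z
      using pos[OF that] that by (force simp: ennreal_eq_0_iff mult_le_0_iff)
    have hol: "(\<lambda>z. f z - g z) holomorphic_on unit_disc"
      using fg by (auto simp: bloch_def analytic_fun_def intro!: holomorphic_intros)
    have "((\<lambda>z. f z - g z) has_field_derivative 0) (at z)" if "z \<in> unit_disc" for z
      using holomorphic_derivI[OF hol open_ball that] d0[OF that] by simp
    then obtain c where c: "\<And>z. z \<in> unit_disc \<Longrightarrow> f z - g z = c"
      using DERIV_zero_connected_constant[of unit_disc "{}" "\<lambda>z. f z - g z"]
        holomorphic_on_imp_continuous_on[OF hol] connected_ball by blast
    have "f z = g z" if "z \<in> unit_disc" for z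
      using c[OF that] c[of 0] f0 by simp
    moreover have "f z = g z" if "z \<notin> unit_disc" for z
      using fg that by (auto simp: bloch_def analytic_fun_def)
    ultimately show "f = g" by blast
  qed (auto simp: norm_dist_def bloch_norm_def)
qed

end

theory Submission
  imports Defs
begin

text \<open>
  Write \<open>(T f)' = u\<^sub>0 f^(m)(\<phi>) + u\<^sub>1 f^(m+1)(\<phi>) + u\<^sub>2 f^(m+2)(\<phi>)\<close>, and let \<open>A\<close>, \<open>B\<close>, \<open>D\<close> be the
  essential norm, the maximum over the coefficients and the maximum over the test functions. The
  estimates form a cycle. For \<open>A \<le> a B\<close>, compose \<open>T\<close> with the dilation \<open>f(z) \<mapsto> f(r z)\<close>, which gives a
  compact operator by Montel's theorem; the difference is uniformly small where \<open>\<bar>\<phi>\<bar> \<le> \<delta>\<close> as \<open>r\<close> tends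
  to 1, and Cauchy's estimates control it where \<open>\<bar>\<phi>\<bar> > \<delta>\<close>. For \<open>B \<le> b D\<close>, evaluate the derivatives of the
  three test functions at their own centre and invert a \<open>3 \<times> 3\<close> matrix of rising factorials. For
  \<open>D \<le> 2 A\<close>, apply \<open>T - L\<close> with \<open>L\<close> compact to differences of test functions.
\<close>

section \<open>The function spaces\<close>

lemma Hinf_norm_le_iff:
  "0 \<le> M \<Longrightarrow> Hinf_norm f \<le> ennreal M \<longleftrightarrow> (\<forall>z\<in>unit_disc. cmod (f z) \<le> M)"
  by (simp add: Hinf_norm_def SUP_le_iff)

lemma Hinf_normD: "Hinf_norm f \<le> 1 \<Longrightarrow> z \<in> unit_disc \<Longrightarrow> cmod (f z) \<le> 1"
  using Hinf_norm_le_iff[of 1 f] by auto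

lemma HinfI:
  assumes "f \<in> analytic_fun" "\<And>z. z \<in> unit_disc \<Longrightarrow> cmod (f z) \<le> M"
  shows "f \<in> Hinf"
proof -
  have "0 \<le> M"
    using order_trans[OF norm_ge_zero assms(2)[of 0]] by simp
  then have "Hinf_norm f \<le> ennreal M"
    using assms(2) by (simp add: Hinf_norm_le_iff)
  then show ?thesis
    using assms(1) by (auto simp: Hinf_def intro: le_less_trans)
qed

lemma Hinf_holomorphic: "f \<in> Hinf \<Longrightarrow> f holomorphic_on unit_disc"
  by (simp add: Hinf_def analytic_fun_def)

lemma Hinf_cmult:
  assumes "f \<in> Hinf"
  shows "(\<lambda>z. c * f z) \<in> Hinf"
proof -
  obtain M where M: "0 \<le> M" "Hinf_norm f = ennreal M"
    using assms by (auto simp: Hinf_def less_top_ennreal)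
  have "cmod (f z) \<le> M" if "z \<in> unit_disc" for z
    using Hinf_norm_le_iff[OF M(1), of f] M(2) that by simp
  then show ?thesis
    using assms by (intro HinfI[where M = "cmod c * M"])
      (auto simp: Hinf_def analytic_fun_def norm_mult intro!: holomorphic_intros mult_left_mono)
qed

lemma Hinf_add:
  assumes "f \<in> Hinf" "g \<in> Hinf"
  shows "(\<lambda>z. f z + g z) \<in> Hinf"
proof -
  obtain M N where M: "0 \<le> M" "Hinf_norm f = ennreal M" and N: "0 \<le> N" "Hinf_norm g = ennreal N"
    using assms by (auto simp: Hinf_def less_top_ennreal)
  have "cmod (f z) \<le> M" "cmod (g z) \<le> N" if "z \<in> unit_disc" for z
    using Hinf_norm_le_iff[OF M(1), of f] Hinf_norm_le_iff[OF N(1), of g] M(2) N(2) that by simp_all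
  then show ?thesis
    using assms by (intro HinfI[where M = "M + N"])
      (auto simp: Hinf_def analytic_fun_def
        intro!: holomorphic_intros order_trans[OF norm_triangle_ineq] add_mono)
qed

lemma Hinf_diff: "f \<in> Hinf \<Longrightarrow> g \<in> Hinf \<Longrightarrow> (\<lambda>z. f z - g z) \<in> Hinf"
  using Hinf_add[OF _ Hinf_cmult[of g "-1"]] by simp

lemma bloch_holomorphic: "f \<in> bloch \<mu> \<Longrightarrow> f holomorphic_on unit_disc"
  by (simp add: bloch_def analytic_fun_def)

lemma holomorphic_disc_differentiable:
  "f holomorphic_on unit_disc \<Longrightarrow> z \<in> unit_disc \<Longrightarrow> f field_differentiable at z"
  by (rule holomorphic_on_imp_differentiable_at[of _ unit_disc]) auto

lemma bloch_norm_le: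
  assumes "cmod (f 0) \<le> a" "\<And>z. z \<in> unit_disc \<Longrightarrow> ennreal (\<mu> z * cmod (deriv f z)) \<le> b"
  shows "bloch_norm \<mu> f \<le> ennreal a + b"
  unfolding bloch_norm_def using assms by (intro add_mono SUP_least ennreal_leI)

lemma bloch_norm_ge_pointwise:
  assumes "radial_weight \<mu>" "z \<in> unit_disc"
  shows "ennreal (cmod (f 0) + \<mu> z * cmod (deriv f z)) \<le> bloch_norm \<mu> f"
proof -
  have "0 \<le> \<mu> z"
    using assms unfolding radial_weight_def by (meson less_imp_le)
  then have "ennreal (cmod (f 0) + \<mu> z * cmod (deriv f z)) =
      ennreal (cmod (f 0)) + ennreal (\<mu> z * cmod (deriv f z))"
    by simp
  also have "\<dots> \<le> bloch_norm \<mu> f"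
    unfolding bloch_norm_def by (intro add_left_mono SUP_upper assms(2))
  finally show ?thesis .
qed

text \<open>The disc is nonempty, so the constant \<open>cmod (f 0)\<close> can be moved inside the
  supremum. The norm becomes a supremum of pointwise quantities; homogeneity, the triangle
  inequality and the later passage to pointwise limits then reduce to one \<open>z\<close> at a
  time.\<close>

lemma bloch_norm_eq_SUP:
  assumes "radial_weight \<mu>"
  shows "bloch_norm \<mu> f = (SUP z\<in>unit_disc. ennreal (cmod (f 0) + \<mu> z * cmod (deriv f z)))"
proof -
  have "ennreal (cmod (f 0) + \<mu> z * cmod (deriv f z)) =
      ennreal (\<mu> z * cmod (deriv f z)) + ennreal (cmod (f 0))" if "z \<in> unit_disc" for z
  proof -
    have "0 \<le> \<mu> z"
      using assms that unfolding radial_weight_def by (meson less_imp_le)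
    then show ?thesis
      by (simp add: add.commute)
  qed
  then have "(SUP z\<in>unit_disc. ennreal (cmod (f 0) + \<mu> z * cmod (deriv f z))) =
      (SUP z\<in>unit_disc. ennreal (\<mu> z * cmod (deriv f z)) + ennreal (cmod (f 0)))"
    by (intro SUP_cong) auto
  also have "\<dots> = (SUP z\<in>unit_disc. ennreal (\<mu> z * cmod (deriv f z))) + ennreal (cmod (f 0))"
    by (rule ennreal_SUP_add_left) simp
  finally show ?thesis
    by (simp add: bloch_norm_def add.commute)
qed

lemma bloch_norm_cmult:
  assumes "radial_weight \<mu>" "f holomorphic_on unit_disc"
  shows "bloch_norm \<mu> (\<lambda>z. c * f z) = ennreal (cmod c) * bloch_norm \<mu> f"
  unfolding bloch_norm_eq_SUP[OF assms(1)] SUP_mult_left_ennreal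
proof (intro SUP_cong refl)
  fix z assume "z \<in> unit_disc"
  then have "cmod (c * f 0) + \<mu> z * cmod (deriv (\<lambda>z. c * f z) z) =
      cmod c * (cmod (f 0) + \<mu> z * cmod (deriv f z))"
    by (simp add: norm_mult holomorphic_disc_differentiable[OF assms(2)] algebra_simps)
  then show "ennreal (cmod (c * f 0) + \<mu> z * cmod (deriv (\<lambda>z. c * f z) z)) =
      ennreal (cmod c) * ennreal (cmod (f 0) + \<mu> z * cmod (deriv f z))"
    by (simp only: ennreal_mult'[OF norm_ge_zero])
qed

lemma bloch_norm_add_le:
  assumes "radial_weight \<mu>" "f holomorphic_on unit_disc" "g holomorphic_on unit_disc"
  shows "bloch_norm \<mu> (\<lambda>z. f z + g z) \<le> bloch_norm \<mu> f + bloch_norm \<mu> g"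
  unfolding bloch_norm_eq_SUP[OF assms(1), of "\<lambda>z. f z + g z"]
proof (rule SUP_least)
  fix z assume z: "z \<in> unit_disc"
  have \<mu>: "0 \<le> \<mu> z"
    using assms(1) z unfolding radial_weight_def by (meson less_imp_le)
  have "\<mu> z * cmod (deriv (\<lambda>z. f z + g z) z) \<le> \<mu> z * (cmod (deriv f z) + cmod (deriv g z))"
    using z \<mu> by (simp add: holomorphic_disc_differentiable assms mult_left_mono norm_triangle_ineq)
  then have "cmod (f 0 + g 0) + \<mu> z * cmod (deriv (\<lambda>z. f z + g z) z) \<le>
      (cmod (f 0) + \<mu> z * cmod (deriv f z)) + (cmod (g 0) + \<mu> z * cmod (deriv g z))"
    using norm_triangle_ineq[of "f 0" "g 0"] by (simp add: algebra_simps)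
  then have "ennreal (cmod (f 0 + g 0) + \<mu> z * cmod (deriv (\<lambda>z. f z + g z) z)) \<le>
      ennreal (cmod (f 0) + \<mu> z * cmod (deriv f z)) + ennreal (cmod (g 0) + \<mu> z * cmod (deriv g z))"
    using \<mu> by (subst ennreal_plus[symmetric]) (auto simp del: ennreal_plus intro!: ennreal_leI)
  then show "ennreal (cmod (f 0 + g 0) + \<mu> z * cmod (deriv (\<lambda>z. f z + g z) z)) \<le>
      bloch_norm \<mu> f + bloch_norm \<mu> g"
    by (rule order_trans) (intro add_mono bloch_norm_ge_pointwise assms z)
qed

lemma bloch_norm_minus_commute:
  assumes "radial_weight \<mu>" "f holomorphic_on unit_disc" "g holomorphic_on unit_disc"
  shows "bloch_norm \<mu> (\<lambda>z. f z - g z) = bloch_norm \<mu> (\<lambda>z. g z - f z)"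
  using bloch_norm_cmult[OF assms(1), of "\<lambda>z. g z - f z" "-1"] assms
  by (simp add: holomorphic_on_diff)

lemma bloch_diff:
  assumes "radial_weight \<mu>" "f \<in> bloch \<mu>" "g \<in> bloch \<mu>"
  shows "(\<lambda>z. f z - g z) \<in> bloch \<mu>"
proof -
  have "bloch_norm \<mu> (\<lambda>z. f z + (-1) * g z) \<le> bloch_norm \<mu> f + bloch_norm \<mu> (\<lambda>z. (-1) * g z)"
    by (intro bloch_norm_add_le holomorphic_intros bloch_holomorphic[of _ \<mu>] assms)
  also have "bloch_norm \<mu> (\<lambda>z. (-1) * g z) = bloch_norm \<mu> g"
    using bloch_norm_cmult[OF assms(1) bloch_holomorphic[OF assms(3)], of "-1"] by simp
  also have "bloch_norm \<mu> f + bloch_norm \<mu> g < \<infinity>"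
    using assms by (auto simp: bloch_def)
  finally show ?thesis
    using assms by (auto simp: bloch_def analytic_fun_def intro!: holomorphic_intros)
qed

lemma linear_op_diff:
  assumes "linear_op Hinf Y T" "f \<in> Hinf" "g \<in> Hinf"
  shows "T (\<lambda>z. f z - g z) = (\<lambda>z. T f z - T g z)"
proof -
  have "T (\<lambda>z. f z + (-1) * g z) = (\<lambda>z. T f z + T (\<lambda>z. (-1) * g z) z)"
    using assms Hinf_cmult[of g "-1"] by (simp only: linear_op_def)
  also have "T (\<lambda>z. (-1) * g z) = (\<lambda>z. (-1) * T g z)"
    using assms(1,3) by (simp only: linear_op_def)
  finally show ?thesis
    by simp
qed

section \<open>Limits superior at the boundary\<close>

definition bdry_SUP :: "(complex \<Rightarrow> complex) \<Rightarrow> (complex \<Rightarrow> ennreal) \<Rightarrow> real \<Rightarrow> ennreal"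
  where "bdry_SUP \<phi> F \<delta> = (SUP z\<in>{z \<in> unit_disc. \<delta> < cmod (\<phi> z)}. F z)"

text \<open>If the supremum of \<open>cmod (\<phi> z)\<close> is below 1, taking it as \<delta>
  leaves an empty index set, so the infimum agrees with the conventional value 0. Otherwise
  \<open>bdry_SUP\<close> decreases in \<delta> and its left limit at 1 is its infimum.\<close>

lemma limsup_to_bdry_eq_INF:
  assumes "\<phi> ` unit_disc \<subseteq> unit_disc"
  shows "limsup_to_bdry \<phi> F = (INF \<delta>\<in>{..<1}. bdry_SUP \<phi> F \<delta>)"
proof (cases "(SUP z\<in>unit_disc. cmod (\<phi> z)) < 1")
  case True
  have "bdd_above ((\<lambda>z. cmod (\<phi> z)) ` unit_disc)"
    using assms by (intro bdd_aboveI[of _ 1]) (auto simp: less_imp_le)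
  then have "{z \<in> unit_disc. (SUP z\<in>unit_disc. cmod (\<phi> z)) < cmod (\<phi> z)} = {}"
    by (auto simp: not_less intro!: cSUP_upper)
  then have "bdry_SUP \<phi> F (SUP z\<in>unit_disc. cmod (\<phi> z)) = 0"
    unfolding bdry_SUP_def by (simp only: image_empty Sup_empty bot_ennreal)
  with True have "(INF \<delta>\<in>{..<1}. bdry_SUP \<phi> F \<delta>) \<le> 0"
    by (metis INF_lower lessThan_iff)
  with True show ?thesis
    by (simp add: limsup_to_bdry_def)
next
  case False
  then show ?thesis
    unfolding limsup_to_bdry_def bdry_SUP_def
    using tendsto_Lim[OF trivial_limit_at_left_real limsup_to_bdry_tendsto[where F=F]] by simp
qed

lemma bdry_SUP_tendsto:
  assumes "\<phi> ` unit_disc \<subseteq> unit_disc"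
  shows "(bdry_SUP \<phi> F \<longlongrightarrow> limsup_to_bdry \<phi> F) (at_left 1)"
  unfolding limsup_to_bdry_eq_INF[OF assms] unfolding bdry_SUP_def by (rule limsup_to_bdry_tendsto)

lemma bdry_SUP_upper: "z \<in> unit_disc \<Longrightarrow> \<delta> < cmod (\<phi> z) \<Longrightarrow> F z \<le> bdry_SUP \<phi> F \<delta>"
  unfolding bdry_SUP_def by (rule SUP_upper) simp

section \<open>Cauchy estimates and dilations\<close>

text \<open>Cauchy's inequality on the circle about \<open>w\<close> whose radius is half the
  distance from \<open>w\<close> to the boundary. The radius \<open>R\<close> is kept general
  because differences \<open>f - dilate r f\<close> are uniformly small only on discs smaller than
  the unit disc.\<close>

lemma higher_deriv_bound:
  assumes "f holomorphic_on ball 0 R" "\<And>z. z \<in> ball 0 R \<Longrightarrow> cmod (f z) \<le> M" "cmod w < R"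
  shows "cmod ((deriv ^^ k) f w) \<le> fact k * M * (2 / (R - cmod w)) ^ k"
proof -
  define s where "s = (R - cmod w) / 2"
  have s: "0 < s"
    using assms(3) by (simp add: s_def)
  have sub: "cball w s \<subseteq> ball 0 R"
    using assms(3) by (auto simp: cball_subset_ball_iff s_def field_simps)
  have "cmod ((deriv ^^ k) f w) \<le> fact k * M / s ^ k"
  proof (rule Cauchy_inequality[OF _ _ s])
    show "f holomorphic_on ball w s"
      using assms(1) ball_subset_cball sub by (blast intro: holomorphic_on_subset)
    show "continuous_on (cball w s) f"
      using assms(1) sub by (blast intro: holomorphic_on_subset holomorphic_on_imp_continuous_on)
    show "cmod (f x) \<le> M" if "cmod (w - x) = s" for x
      using that sub by (intro assms(2)) (auto simp: dist_norm)
  qed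
  also have "\<dots> = fact k * M * (2 / (R - cmod w)) ^ k"
    using assms(3) by (simp add: s_def power_divide)
  finally show ?thesis .
qed

text \<open>Since \<open>1 + cmod w \<le> 2\<close>, the factor \<open>2 / (1 - cmod w)\<close> is
  at most \<open>4 / (1 - (cmod w)\<^sup>2)\<close>, the form in which the theorem measures the
  distance to the boundary.\<close>

lemma higher_deriv_bound_disc:
  assumes "f holomorphic_on unit_disc" "\<And>z. z \<in> unit_disc \<Longrightarrow> cmod (f z) \<le> M" "w \<in> unit_disc"
  shows "cmod ((deriv ^^ k) f w) \<le> fact k * 4 ^ k * M / (1 - (cmod w)\<^sup>2) ^ k"
proof -
  have M: "0 \<le> M"
    using order_trans[OF norm_ge_zero assms(2)[of 0]] by simp
  have w: "cmod w < 1"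
    using assms(3) by simp
  have "(1 - cmod w) * (1 + cmod w) \<le> (1 - cmod w) * 2"
    using w by (intro mult_left_mono) auto
  then have "2 * (1 - (cmod w)\<^sup>2) \<le> 4 * (1 - cmod w)"
    by (simp add: power2_eq_square algebra_simps)
  then have "2 / (1 - cmod w) \<le> 4 / (1 - (cmod w)\<^sup>2)"
    using w by (simp add: divide_simps power_less_one_iff abs_square_less_1)
  then have "fact k * M * (2 / (1 - cmod w)) ^ k \<le> fact k * M * (4 / (1 - (cmod w)\<^sup>2)) ^ k"
    using M w by (intro mult_left_mono power_mono) auto
  then show ?thesis
    using higher_deriv_bound[OF assms(1,2) w, of k] by (simp add: power_divide field_simps)
qed

text \<open>The cutoff keeps dilates in \<open>analytic_fun\<close>, whose members vanish off the
  disc. For \<open>0 \<le> r < 1\<close> only the values of \<open>f\<close> on the compact disc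
  \<open>cball 0 r\<close> enter, which is the source of compactness.\<close>

definition dilate :: "real \<Rightarrow> (complex \<Rightarrow> complex) \<Rightarrow> (complex \<Rightarrow> complex)"
  where "dilate r f = (\<lambda>z. if z \<in> unit_disc then f (of_real r * z) else 0)"

lemma dilate_in_disc:
  assumes "0 \<le> r" "r < 1" "z \<in> unit_disc"
  shows "of_real r * z \<in> unit_disc" "cmod (of_real r * z) \<le> r"
  using assms mult_left_mono[of "cmod z" 1 r] by (auto simp: norm_mult)

lemma dilate_holomorphic:
  assumes "f holomorphic_on unit_disc" "0 \<le> r" "r < 1"
  shows "dilate r f \<in> analytic_fun"
proof -
  have "(\<lambda>z. f (of_real r * z)) holomorphic_on unit_disc"
    using dilate_in_disc(1)[OF assms(2,3)]
    by (intro holomorphic_on_compose_gen[OF _ assms(1), unfolded o_def] holomorphic_intros) blast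
  then have "dilate r f holomorphic_on unit_disc"
    by (rule holomorphic_transform) (simp add: dilate_def)
  then show ?thesis
    by (simp add: analytic_fun_def dilate_def)
qed

lemma dilate_Hinf:
  assumes "f holomorphic_on unit_disc" "\<And>z. z \<in> unit_disc \<Longrightarrow> cmod (f z) \<le> M" "0 \<le> r" "r < 1"
  shows "dilate r f \<in> Hinf"
  by (rule HinfI[where M = M, OF dilate_holomorphic[OF assms(1,3,4)]])
    (simp only: dilate_def if_True assms(2)[OF dilate_in_disc(1)[OF assms(3,4)]])

lemma dilate_of_Hinf:
  assumes "f \<in> Hinf" "0 \<le> r" "r < 1"
  shows "dilate r f \<in> Hinf"
proof -
  obtain M where M: "0 \<le> M" "Hinf_norm f = ennreal M"
    using assms(1) by (auto simp: Hinf_def less_top_ennreal)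
  show ?thesis
    by (rule dilate_Hinf[OF Hinf_holomorphic[OF assms(1)] _ assms(2,3), of M])
      (use Hinf_norm_le_iff[OF M(1), of f] M(2) in auto)
qed

text \<open>Mean value estimate between \<open>r w\<close> and \<open>w\<close> in the convex ball
  of radius \<rho>, where Cauchy's estimate bounds the derivative by
  \<open>2 / (1 - \<rho>)\<close>.\<close>

lemma dilate_error:
  assumes f: "f holomorphic_on unit_disc" "\<And>z. z \<in> unit_disc \<Longrightarrow> cmod (f z) \<le> 1"
    and r: "0 \<le> r" "r < 1" and \<rho>: "\<rho> < 1" and w: "cmod w < \<rho>"
  shows "cmod (f w - dilate r f w) \<le> 2 * (1 - r) / (1 - \<rho>)"
proof -
  have "cmod (f w - f (of_real r * w)) \<le> 2 / (1 - \<rho>) * cmod (w - of_real r * w)"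
  proof (rule field_differentiable_bound[of "ball 0 \<rho>" f "deriv f"])
    fix z :: complex assume z: "z \<in> ball 0 \<rho>"
    then show "(f has_field_derivative deriv f z) (at z within ball 0 \<rho>)"
      using \<rho> by (intro has_field_derivative_at_within[OF holomorphic_derivI[OF f(1)]]) auto
    have "cmod ((deriv ^^ 1) f z) \<le> fact 1 * 1 * (2 / (1 - cmod z)) ^ 1"
      by (rule higher_deriv_bound[OF f]) (use z \<rho> in auto)
    then have "cmod (deriv f z) \<le> 2 / (1 - cmod z)"
      by simp
    also have "\<dots> \<le> 2 / (1 - \<rho>)"
      using z \<rho> by (intro divide_left_mono) auto
    finally show "cmod (deriv f z) \<le> 2 / (1 - \<rho>)" .
  next
    have "r * cmod w \<le> 1 * cmod w"
      using r by (intro mult_right_mono) auto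
    then show "of_real r * w \<in> ball 0 \<rho>"
      using r w by (simp add: norm_mult)
  qed (use w in auto)
  also have "cmod (w - of_real r * w) = (1 - r) * cmod w"
  proof -
    have "w - of_real r * w = of_real (1 - r) * w"
      by (simp add: left_diff_distrib)
    then show ?thesis
      using r by (metis abs_of_pos diff_gt_0_iff_gt norm_mult norm_of_real)
  qed
  also have "2 / (1 - \<rho>) * ((1 - r) * cmod w) \<le> 2 / (1 - \<rho>) * ((1 - r) * 1)"
    by (rule mult_left_mono, rule mult_left_mono) (use w \<rho> r in auto)
  also have "f (of_real r * w) = dilate r f w"
    using w \<rho> by (simp add: dilate_def)
  finally show ?thesis
    by (simp only: mult_1_right times_divide_eq_left)
qed

section \<open>The test functions\<close>

text \<open>Both follow from \<open>1 - cmod a * cmod w\<close> as a lower bound. The first makes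
  the test functions bounded by 1; the second is uniform in the centre \<open>a\<close> and serves
  when \<open>a\<close> tends to the boundary.\<close>

lemma cmod_one_minus_mult_ge:
  assumes "cmod a \<le> 1" "cmod w \<le> 1"
  shows "1 - cmod a \<le> cmod (1 - cnj a * w)" "1 - cmod w \<le> cmod (1 - cnj a * w)"
proof -
  have "1 - cmod a * cmod w \<le> cmod (1 - cnj a * w)"
    using norm_triangle_ineq2[of 1 "cnj a * w"] by (simp add: norm_mult)
  then show "1 - cmod a \<le> cmod (1 - cnj a * w)" "1 - cmod w \<le> cmod (1 - cnj a * w)"
    using mult_left_mono[OF assms(2), of "cmod a"] mult_right_mono[OF assms(1), of "cmod w"] by auto
qed

lemma one_minus_mult_nonzero:
  assumes "a \<in> unit_disc" "w \<in> unit_disc"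
  shows "1 - cnj a * w \<noteq> 0"
  using cmod_one_minus_mult_ge(1)[of a w] assms by auto

lemma has_field_derivative_inverse_linear_power:
  fixes b w :: complex
  assumes "1 - b * w \<noteq> 0"
  shows "((\<lambda>w. c / (1 - b * w) ^ n) has_field_derivative c * of_nat n * b / (1 - b * w) ^ Suc n) (at w)"
proof -
  have "((\<lambda>w. inverse (1 - b * w)) has_field_derivative b / (1 - b * w)\<^sup>2) (at w)"
    using assms by (auto intro!: derivative_eq_intros simp: power2_eq_square field_simps)
  then have "((\<lambda>w. c * inverse (1 - b * w) ^ n) has_field_derivative
      c * (of_nat n * (b / (1 - b * w)\<^sup>2 * inverse (1 - b * w) ^ (n - Suc 0)))) (at w)"
    by (intro DERIV_cmult DERIV_power)
  \<comment> \<open>The power rule produces the truncated exponent \<open>n - 1\<close>; for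
    \<open>n = 0\<close> the factor \<open>of_nat n\<close> annihilates the term, hence the case
    split.\<close>
  moreover have "c * (of_nat n * (b / (1 - b * w)\<^sup>2 * inverse (1 - b * w) ^ (n - Suc 0))) =
      c * of_nat n * b / (1 - b * w) ^ Suc n"
    using assms by (cases n) (auto simp: power2_eq_square power_inverse divide_simps)
  ultimately show ?thesis
    by (simp only: power_inverse divide_inverse)
qed

lemma test_fun_holomorphic: "a \<in> unit_disc \<Longrightarrow> test_fun i a holomorphic_on unit_disc"
  by (rule holomorphic_transform[of "\<lambda>z. (of_real (1 - cmod a) / (1 - cnj a * z)) ^ i"])
    (intro holomorphic_intros one_minus_mult_nonzero, auto simp: test_fun_def)

lemma cmod_test_fun_le_1:
  assumes "a \<in> unit_disc" "z \<in> unit_disc"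
  shows "cmod (test_fun i a z) \<le> 1"
proof -
  have "cmod (of_real (1 - cmod a) / (1 - cnj a * z)) = (1 - cmod a) / cmod (1 - cnj a * z)"
    using assms(1) by (simp only: norm_divide norm_of_real) simp
  also have "\<dots> \<le> 1"
    using assms cmod_one_minus_mult_ge(1)[of a z] by (intro divide_le_eq_1[THEN iffD2]) auto
  finally show ?thesis
    using assms(2) by (simp add: test_fun_def norm_power power_le_one)
qed

lemma test_fun_Hinf:
  assumes "a \<in> unit_disc"
  shows "test_fun i a \<in> Hinf" "Hinf_norm (test_fun i a) \<le> 1"
proof -
  show "test_fun i a \<in> Hinf"
    by (rule HinfI[where M = 1])
      (use assms cmod_test_fun_le_1 test_fun_holomorphic in \<open>auto simp: analytic_fun_def test_fun_def\<close>)
  show "Hinf_norm (test_fun i a) \<le> 1"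
    using Hinf_norm_le_iff[of 1 "test_fun i a"] cmod_test_fun_le_1[OF assms] by simp
qed

text \<open>Differentiating the power \<open>-(i + k)\<close> of \<open>1 - cnj a * w\<close>
  contributes the factor \<open>(i + k) * cnj a\<close>; these factors accumulate to a rising
  factorial starting at \<open>i\<close>.\<close>

lemma higher_deriv_test_fun:
  assumes a: "a \<in> unit_disc" and "w \<in> unit_disc"
  shows "(deriv ^^ k) (test_fun i a) w =
    pochhammer (of_nat i) k * cnj a ^ k * of_real (1 - cmod a) ^ i / (1 - cnj a * w) ^ (i + k)"
  using assms(2)
proof (induction k arbitrary: w)
  case 0
  then show ?case
    by (simp add: test_fun_def power_divide)
next
  case (Suc k)
  define c where "c = pochhammer (of_nat i) k * cnj a ^ k * of_real (1 - cmod a) ^ i"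
  have "((\<lambda>w. c / (1 - cnj a * w) ^ (i + k)) has_field_derivative
      c * of_nat (i + k) * cnj a / (1 - cnj a * w) ^ Suc (i + k)) (at w)"
    by (intro has_field_derivative_inverse_linear_power one_minus_mult_nonzero a Suc.prems)
  then have "((deriv ^^ k) (test_fun i a) has_field_derivative
      c * of_nat (i + k) * cnj a / (1 - cnj a * w) ^ Suc (i + k)) (at w)"
    by (rule has_field_derivative_transform_within_open[of _ _ _ unit_disc])
      (use Suc in \<open>auto simp: c_def\<close>)
  then show ?case
    by (auto dest!: DERIV_imp_deriv simp: c_def pochhammer_Suc mult_ac)
qed

text \<open>The numerator carries \<open>(1 - cmod (a l)) ^ i\<close>, which vanishes in the limit
  because \<open>i \<ge> 1\<close>, while the denominator stays above a power of
  \<open>1 - cmod w\<close> for the fixed point \<open>w\<close>.\<close>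

lemma higher_deriv_test_fun_tendsto_0:
  assumes a: "\<And>l. a l \<in> unit_disc" "(\<lambda>l. cmod (a l)) \<longlonglongrightarrow> 1" and w: "w \<in> unit_disc" and "1 \<le> i"
  shows "(\<lambda>l. (deriv ^^ k) (test_fun i (a l)) w) \<longlonglongrightarrow> 0"
proof (rule Lim_null_comparison)
  define C where "C = pochhammer (real i) k / (1 - cmod w) ^ (i + k)"
  show "\<forall>\<^sub>F l in sequentially. cmod ((deriv ^^ k) (test_fun i (a l)) w) \<le> C * (1 - cmod (a l)) ^ i"
  proof (intro always_eventually allI)
    fix l
    have p: "cmod (pochhammer (of_nat i) k) = pochhammer (real i) k"
      by (simp add: pochhammer_of_nat)
    have a1: "cmod (a l) < 1"
      using a(1)[of l] by simp
    have "cmod ((deriv ^^ k) (test_fun i (a l)) w) =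
        pochhammer (real i) k * cmod (a l) ^ k * (1 - cmod (a l)) ^ i / cmod (1 - cnj (a l) * w) ^ (i + k)"
      unfolding higher_deriv_test_fun[OF a(1) w] norm_divide norm_mult norm_power p norm_of_real complex_mod_cnj
      using a1 by simp
    also have "\<dots> \<le> pochhammer (real i) k * 1 * (1 - cmod (a l)) ^ i / (1 - cmod w) ^ (i + k)"
    proof (rule frac_le)
      show "pochhammer (real i) k * cmod (a l) ^ k * (1 - cmod (a l)) ^ i \<le>
          pochhammer (real i) k * 1 * (1 - cmod (a l)) ^ i"
        using a1 \<open>1 \<le> i\<close> by (intro mult_right_mono mult_left_mono power_le_one pochhammer_nonneg) auto
      show "(1 - cmod w) ^ (i + k) \<le> cmod (1 - cnj (a l) * w) ^ (i + k)"
        using a1 w cmod_one_minus_mult_ge(2)[of "a l" w] by (intro power_mono) auto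
    qed (use w a1 \<open>1 \<le> i\<close> in \<open>auto simp: Suc_le_eq intro!: mult_nonneg_nonneg pochhammer_nonneg\<close>)
    finally show "cmod ((deriv ^^ k) (test_fun i (a l)) w) \<le> C * (1 - cmod (a l)) ^ i"
      by (simp add: C_def)
  qed
  have "(\<lambda>l. C * (1 - cmod (a l)) ^ i) \<longlonglongrightarrow> C * (1 - 1) ^ i"
    by (intro tendsto_intros a(2))
  then show "(\<lambda>l. C * (1 - cmod (a l)) ^ i) \<longlonglongrightarrow> 0"
    using \<open>1 \<le> i\<close> by (simp add: power_0_left)
qed

text \<open>The sum of the constants obtained below for \<open>X 0\<close> and \<open>X 1\<close>;
  it also dominates the constant 1 for \<open>X 2\<close>, so one constant serves all three
  unknowns.\<close>

definition inversion_const :: "nat \<Rightarrow> real"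
  where "inversion_const m = 1 + (m + 1) * (2 * m + 5) + (m + 1) * (m + 2) + 2 * m + 5"

text \<open>Up to row factors, the matrix of the rising factorials is the Vandermonde-like matrix with
  rows \<open>1, x, x (x + 1)\<close> at \<open>x = m + 1, m + 2, m + 3\<close>, which is inverted by finite differences.\<close>

lemma pochhammer_matrix_inversion:
  fixes X :: "nat \<Rightarrow> complex" and m :: nat
  defines "Y \<equiv> \<lambda>i. \<Sum>j<3. pochhammer (of_nat i) (m + j) * X j"
  assumes "j < 3"
  shows "cmod (X j) \<le> inversion_const m * (\<Sum>i\<in>{1..3}. cmod (Y i))"
proof -
  define Z where "Z i = X 0 + of_nat (i + m) * X 1 + of_nat (i + m) * of_nat (i + m + 1) * X 2" for i
  have "Y i = pochhammer (of_nat i) m * Z i" for i :: nat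
  proof -
    have p: "pochhammer (of_nat i) (m + j) =
        pochhammer (of_nat i) m * pochhammer (of_nat (i + m)) j" for j
      by (simp add: pochhammer_product')
    show ?thesis
      unfolding Y_def Z_def p by (simp add: numeral_3_eq_3 numeral_2_eq_2 pochhammer_Suc distrib_left mult_ac)
  qed
  \<comment> \<open>The row factor is a positive integer for \<open>i \<ge> 1\<close>, so dividing
    it out of \<open>Y i\<close> cannot increase the modulus.\<close>
  moreover have "1 \<le> cmod (pochhammer (of_nat i) m)" if "1 \<le> i" for i
    using pochhammer_pos[of i m] that by (simp add: pochhammer_of_nat Suc_le_eq)
  ultimately have ZY: "cmod (Z i) \<le> cmod (Y i)" if "1 \<le> i" for i
    using that mult_right_mono[of 1 "cmod (pochhammer (of_nat i) m)" "cmod (Z i)"] by (simp add: norm_mult)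
  define S where "S = (\<Sum>i\<in>{1..3}. cmod (Y i))"
  have "{1..3::nat} = {1, 2, 3}"
    by auto
  then have S: "cmod (Z 1) + cmod (Z 2) + cmod (Z 3) \<le> S"
    using ZY[of 1] ZY[of 2] ZY[of 3] by (simp add: S_def)
  then have S12: "cmod (Z 1) \<le> S" "cmod (Z 2) + cmod (Z 1) \<le> S"
    using norm_ge_zero[of "Z 1"] norm_ge_zero[of "Z 2"] norm_ge_zero[of "Z 3"] by linarith+
  have S0: "0 \<le> S"
    by (simp add: S_def sum_nonneg)
  \<comment> \<open>Second difference: the constant and linear parts of \<open>Z\<close> cancel and
    \<open>x * (x + 1)\<close> contributes 2. The first difference then gives \<open>X 1\<close>,
    and back substitution gives \<open>X 0\<close>.\<close>
  have X2: "2 * X 2 = Z 3 - 2 * Z 2 + Z 1"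
    by (simp add: Z_def algebra_simps)
  have "cmod (2 * X 2) \<le> 2 * S"
    unfolding X2 using S norm_triangle_ineq[of "Z 3 - 2 * Z 2" "Z 1"] norm_triangle_ineq4[of "Z 3" "2 * Z 2"]
      norm_ge_zero[of "Z 1"] norm_ge_zero[of "Z 3"]
    unfolding norm_mult[of 2] by (simp del: norm_ge_zero)
  then have B2: "cmod (X 2) \<le> S"
    by (simp add: norm_mult)
  have X1: "X 1 = Z 2 - Z 1 - of_nat (2 * m + 4) * X 2"
    by (simp add: Z_def algebra_simps)
  have "cmod (X 1) \<le> cmod (Z 2) + cmod (Z 1) + cmod (of_nat (2 * m + 4) * X 2)"
    unfolding X1
    using norm_triangle_ineq4[of "Z 2 - Z 1" "of_nat (2 * m + 4) * X 2"] norm_triangle_ineq4[of "Z 2" "Z 1"] by simp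
  also have "\<dots> \<le> S + (2 * m + 4) * S"
    unfolding norm_mult norm_of_nat using B2 by (intro add_mono[OF S12(2)] mult_mono) auto
  finally have B1: "cmod (X 1) \<le> (2 * m + 5) * S"
    by (simp add: algebra_simps)
  have X0: "X 0 = Z 1 - of_nat (m + 1) * X 1 - of_nat ((m + 1) * (m + 2)) * X 2"
    by (simp add: Z_def algebra_simps)
  have "cmod (X 0) \<le> cmod (Z 1) + cmod (of_nat (m + 1) * X 1) + cmod (of_nat ((m + 1) * (m + 2)) * X 2)"
    unfolding X0
    using norm_triangle_ineq4[of "Z 1 - of_nat (m + 1) * X 1" "of_nat ((m + 1) * (m + 2)) * X 2"]
      norm_triangle_ineq4[of "Z 1" "of_nat (m + 1) * X 1"] by linarith
  also have "\<dots> \<le> S + real (m + 1) * ((2 * m + 5) * S) + real ((m + 1) * (m + 2)) * S"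
    unfolding norm_mult norm_of_nat by (intro add_mono mult_left_mono S12 B1 B2) auto
  finally have B0: "cmod (X 0) \<le> (1 + (m + 1) * (2 * m + 5) + (m + 1) * (m + 2)) * S"
    by (simp add: algebra_simps)
  have "x \<le> inversion_const m * S" if "x \<le> c * S" "c \<le> inversion_const m" for x c
    using order_trans[OF that(1) mult_right_mono[OF that(2) S0]] .
  note * = this
  have "j = 0 \<or> j = 1 \<or> j = 2"
    using assms(2) by auto
  then show ?thesis
    unfolding S_def[symmetric] using *[OF B0] *[OF B1] *[of "cmod (X 2)" 1] B2
    by (auto simp: inversion_const_def)
qed

section \<open>Bounded operators\<close>

text \<open>Cauchy's estimate on the intermediate ball of radius \<rho>, halfway between \<delta>
  and 1, applied to the bound of \<open>dilate_error\<close>. The constant depends on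
  \<open>k\<close> and \<delta> only, so the error is uniform over the unit ball of bounded
  functions.\<close>

lemma dilate_error_higher_deriv:
  assumes "0 \<le> \<delta>" "\<delta> < 1"
  obtains C where "0 \<le> C"
    "\<And>r f w. 0 \<le> r \<Longrightarrow> r < 1 \<Longrightarrow> f holomorphic_on unit_disc \<Longrightarrow>
      (\<And>z. z \<in> unit_disc \<Longrightarrow> cmod (f z) \<le> 1) \<Longrightarrow> cmod w \<le> \<delta> \<Longrightarrow>
      cmod ((deriv ^^ k) (\<lambda>z. f z - dilate r f z) w) \<le> C * (1 - r)"
proof -
  define \<rho> where "\<rho> = (1 + \<delta>) / 2"
  have \<rho>: "\<delta> < \<rho>" "\<rho> < 1"
    using assms by (simp_all add: \<rho>_def)
  define C where "C = fact k * (2 / (1 - \<rho>)) * (2 / (\<rho> - \<delta>)) ^ k"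
  show thesis
  proof (rule that[of C])
    show "0 \<le> C"
      using \<rho> by (simp add: C_def)
    fix r :: real and f :: "complex \<Rightarrow> complex" and w :: complex
    assume r: "0 \<le> r" "r < 1" and f: "f holomorphic_on unit_disc"
      "\<And>z. z \<in> unit_disc \<Longrightarrow> cmod (f z) \<le> 1" and w: "cmod w \<le> \<delta>"
    have sub: "ball 0 \<rho> \<subseteq> unit_disc"
      using \<rho> by (simp add: ball_subset_ball_iff)
    have "cmod ((deriv ^^ k) (\<lambda>z. f z - dilate r f z) w)
        \<le> fact k * (2 * (1 - r) / (1 - \<rho>)) * (2 / (\<rho> - cmod w)) ^ k"
    proof (rule higher_deriv_bound)
      show "(\<lambda>z. f z - dilate r f z) holomorphic_on ball 0 \<rho>"
        using dilate_holomorphic[OF f(1) r] f(1) holomorphic_on_subset[OF _ sub]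
        by (auto simp: analytic_fun_def intro!: holomorphic_on_diff)
      show "cmod (f z - dilate r f z) \<le> 2 * (1 - r) / (1 - \<rho>)" if "z \<in> ball 0 \<rho>" for z
        using that by (intro dilate_error f r \<rho>) auto
      show "cmod w < \<rho>"
        using w \<rho> by simp
    qed
    also have "\<dots> \<le> fact k * (2 * (1 - r) / (1 - \<rho>)) * (2 / (\<rho> - \<delta>)) ^ k"
      using w \<rho> r by (intro mult_left_mono power_mono divide_left_mono) auto
    also have "\<dots> = C * (1 - r)"
      by (simp add: C_def)
    finally show "cmod ((deriv ^^ k) (\<lambda>z. f z - dilate r f z) w) \<le> C * (1 - r)" .
  qed
qed

lemma bloch_norm_triangle:
  assumes "radial_weight \<mu>" "f \<in> bloch \<mu>" "g \<in> bloch \<mu>" "h \<in> bloch \<mu>"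
  shows "bloch_norm \<mu> (\<lambda>z. f z - h z) \<le>
    bloch_norm \<mu> (\<lambda>z. f z - g z) + bloch_norm \<mu> (\<lambda>z. g z - h z)"
proof -
  have "bloch_norm \<mu> (\<lambda>z. (f z - g z) + (g z - h z)) \<le>
      bloch_norm \<mu> (\<lambda>z. f z - g z) + bloch_norm \<mu> (\<lambda>z. g z - h z)"
    by (intro bloch_norm_add_le holomorphic_on_diff bloch_holomorphic[of _ \<mu>] assms)
  then show ?thesis
    by simp
qed

section \<open>The operator \<open>T\<close>, the derivative of its images and bounds on the
  coefficients\<close>

locale bounded_T_op =
  fixes m :: nat and \<mu> :: "complex \<Rightarrow> real" and \<psi>\<^sub>1 \<psi>\<^sub>2 \<phi> :: "complex \<Rightarrow> complex"
  assumes weight: "radial_weight \<mu>"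
    and hol_\<psi>\<^sub>1: "\<psi>\<^sub>1 holomorphic_on unit_disc"
    and hol_\<psi>\<^sub>2: "\<psi>\<^sub>2 holomorphic_on unit_disc"
    and hol_\<phi>: "\<phi> holomorphic_on unit_disc"
    and \<phi>_disc: "\<phi> ` unit_disc \<subseteq> unit_disc"
    and bounded: "bounded_op Hinf Hinf_norm (bloch \<mu>) (bloch_norm \<mu>) (T_op m (m + 1) \<psi>\<^sub>1 \<psi>\<^sub>2 \<phi>)"
begin

abbreviation T :: "(complex \<Rightarrow> complex) \<Rightarrow> complex \<Rightarrow> complex"
  where "T \<equiv> T_op m (m + 1) \<psi>\<^sub>1 \<psi>\<^sub>2 \<phi>"

text \<open>The coefficient of \<open>f^(m+j)(\<phi>)\<close> in \<open>(T f)'\<close>.\<close>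

definition coef :: "nat \<Rightarrow> complex \<Rightarrow> complex"
  where "coef j z = (if j = 0 then deriv \<psi>\<^sub>1 z
    else if j = 1 then \<psi>\<^sub>1 z * deriv \<phi> z + deriv \<psi>\<^sub>2 z else \<psi>\<^sub>2 z * deriv \<phi> z)"

text \<open>For \<open>j = 0, 1, 2\<close> these are the three quotients of the theorem, with
  exponents \<open>m\<close>, \<open>n\<close> and \<open>n + 1\<close> for
  \<open>n = m + 1\<close>.\<close>

definition coef_ratio :: "nat \<Rightarrow> complex \<Rightarrow> ennreal"
  where "coef_ratio j z = ennreal (\<mu> z * cmod (coef j z) / (1 - (cmod (\<phi> z))\<^sup>2) ^ (m + j))"

lemma \<phi>_in_disc: "z \<in> unit_disc \<Longrightarrow> \<phi> z \<in> unit_disc"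
  using \<phi>_disc by blast

lemma weight_pos: "z \<in> unit_disc \<Longrightarrow> 0 < \<mu> z"
  using weight unfolding radial_weight_def by blast

lemma linear_T: "linear_op Hinf (bloch \<mu>) T"
  using bounded unfolding bounded_op_def by blast

lemma T_bloch: "f \<in> Hinf \<Longrightarrow> T f \<in> bloch \<mu>"
  using linear_T unfolding linear_op_def by blast

lemma T_bound:
  obtains M where "0 \<le> M"
    "\<And>f c. f \<in> Hinf \<Longrightarrow> (\<And>z. z \<in> unit_disc \<Longrightarrow> cmod (f z) \<le> c) \<Longrightarrow> bloch_norm \<mu> (T f) \<le> ennreal (M * c)"
proof -
  obtain M where M: "\<forall>f\<in>Hinf. bloch_norm \<mu> (T f) \<le> ennreal M * Hinf_norm f"
    using bounded unfolding bounded_op_def by blast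
  show thesis
  \<comment> \<open>The constant in \<open>bounded_op\<close> may be negative, in which case
    \<open>ennreal\<close> truncates it to 0; the maximum makes the product rule for
    \<open>ennreal\<close> applicable.\<close>
  proof (rule that[of "max 0 M"])
    fix f c assume f: "f \<in> Hinf" "\<And>z. z \<in> unit_disc \<Longrightarrow> cmod (f z) \<le> c"
    have c: "0 \<le> c"
      using order_trans[OF norm_ge_zero f(2)[of 0]] by simp
    have "bloch_norm \<mu> (T f) \<le> ennreal M * Hinf_norm f"
      using M f(1) by blast
    also have "\<dots> \<le> ennreal (max 0 M) * ennreal c"
      using f(2) Hinf_norm_le_iff[OF c, of f] by (intro mult_mono ennreal_leI) auto
    also have "\<dots> = ennreal (max 0 M * c)"
      using c by (simp add: ennreal_mult)
    finally show "bloch_norm \<mu> (T f) \<le> ennreal (max 0 M * c)" .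
  qed simp
qed

text \<open>Product and chain rule. Because the two orders of differentiation are consecutive,
  \<open>\<psi>\<^sub>1 * \<phi>'\<close> from the first term and \<open>\<psi>\<^sub>2'\<close>
  from the second fall on the same derivative of \<open>f\<close>, leaving three
  coefficients.\<close>

lemma deriv_T:
  assumes f: "f holomorphic_on unit_disc" and z: "z \<in> unit_disc"
  shows "deriv (T f) z = (\<Sum>j<3. coef j z * (deriv ^^ (m + j)) f (\<phi> z))"
proof -
  have d: "(g has_field_derivative deriv g z) (at z)" if "g holomorphic_on unit_disc" "z \<in> unit_disc" for g z
    using holomorphic_derivI[OF that(1) open_ball that(2)] .
  have h: "((\<lambda>z. (deriv ^^ k) f (\<phi> z)) has_field_derivative
      (deriv ^^ Suc k) f (\<phi> z) * deriv \<phi> z) (at z)" for k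
    using DERIV_chain2[OF d[OF holomorphic_higher_deriv[OF f open_ball] \<phi>_in_disc[OF z]] d[OF hol_\<phi> z], of k]
    by simp
  have "((\<lambda>z. \<psi>\<^sub>1 z * (deriv ^^ m) f (\<phi> z) + \<psi>\<^sub>2 z * (deriv ^^ Suc m) f (\<phi> z)) has_field_derivative
      (\<Sum>j<3. coef j z * (deriv ^^ (m + j)) f (\<phi> z))) (at z)"
    by (rule derivative_eq_intros d[OF hol_\<psi>\<^sub>1 z] d[OF hol_\<psi>\<^sub>2 z] h refl)+
      (simp add: numeral_3_eq_3 coef_def algebra_simps)
  then have "(T f has_field_derivative (\<Sum>j<3. coef j z * (deriv ^^ (m + j)) f (\<phi> z))) (at z)"
    by (rule has_field_derivative_transform_within_open[of _ _ _ unit_disc])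
      (use z in \<open>auto simp: T_op_def\<close>)
  then show ?thesis
    by (rule DERIV_imp_deriv)
qed

text \<open>Testing \<open>T\<close> on \<open>(z - \<phi> w)^(m+j)\<close> isolates one coefficient at \<open>w\<close>.\<close>

lemma coef_bound:
  obtains M where "0 \<le> M" "\<And>z j. z \<in> unit_disc \<Longrightarrow> j < 3 \<Longrightarrow> \<mu> z * cmod (coef j z) \<le> M"
proof -
  obtain M where M: "0 \<le> M" "\<And>f c. f \<in> Hinf \<Longrightarrow> (\<And>z. z \<in> unit_disc \<Longrightarrow> cmod (f z) \<le> c) \<Longrightarrow>
      bloch_norm \<mu> (T f) \<le> ennreal (M * c)"
    using T_bound by blast
  show thesis
  \<comment> \<open>On the disc \<open>z - \<phi> w\<close> has modulus at most 2, and the degree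
    \<open>m + j\<close> of the test polynomial is at most \<open>m + 2\<close>.\<close>
  proof (rule that[of "M * 2 ^ (m + 2)"])
    fix w j assume w: "w \<in> unit_disc" and j: "j < (3::nat)"
    define n where "n = m + j"
    define b where "b = \<phi> w"
    define p where "p z = (if z \<in> unit_disc then (z - b) ^ n else 0)" for z
    have b: "cmod b < 1"
      using \<phi>_in_disc[OF w] by (simp add: b_def)
    have p_hol: "p holomorphic_on unit_disc"
      by (rule holomorphic_transform[of "\<lambda>z. (z - b) ^ n"]) (auto simp: p_def intro!: holomorphic_intros)
    have p_le: "cmod (p z) \<le> 2 ^ n" if "z \<in> unit_disc" for z
      using that b norm_triangle_ineq4[of z b] by (auto simp: p_def norm_power intro!: power_mono)
    have "p \<in> Hinf"
      using p_hol p_le by (intro HinfI[of _ "2 ^ n"]) (auto simp: analytic_fun_def p_def)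
    then have T_p: "bloch_norm \<mu> (T p) \<le> ennreal (M * 2 ^ n)"
      using M(2) p_le by blast
    have "(deriv ^^ (m + i)) p b = (if i = j then fact n else 0)" for i
    proof -
      have "(deriv ^^ (m + i)) p b = (deriv ^^ (m + i)) (\<lambda>z. (z - b) ^ n) b"
        by (rule higher_deriv_transform_within_open[of _ unit_disc])
          (use p_hol b in \<open>auto simp: p_def intro!: holomorphic_intros\<close>)
      \<comment> \<open>One formula covers all cases. For \<open>i < j\<close> the power of 0
        vanishes; for \<open>i > j\<close> truncated subtraction gives \<open>0 ^ 0 = 1\<close>, but
        the rising factorial starts at 0 and vanishes; for \<open>i = j\<close> it starts at 1 and
        equals \<open>fact n\<close>.\<close>
      also have "\<dots> = pochhammer (of_nat (Suc n - (m + i))) (m + i) * 0 ^ (n - (m + i))"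
        by (simp add: higher_deriv_power)
      also have "\<dots> = (if i = j then fact n else 0)"
        using linorder_less_linear[of i j]
        by (auto simp: n_def pochhammer_fact pochhammer_0_left power_0_left)
      finally show ?thesis .
    qed
    then have "deriv (T p) w = (\<Sum>i<3. if i = j then coef j w * fact n else 0)"
      unfolding deriv_T[OF p_hol w] b_def[symmetric] by (intro sum.cong) auto
    also have "\<dots> = coef j w * fact n"
      using j by simp
    finally have "\<mu> w * cmod (coef j w) * fact n = \<mu> w * cmod (deriv (T p) w)"
      by (simp add: norm_mult)
    also have "\<dots> \<le> M * 2 ^ n"
    proof -
      have "ennreal (cmod (T p 0) + \<mu> w * cmod (deriv (T p) w)) \<le> ennreal (M * 2 ^ n)"
        using bloch_norm_ge_pointwise[OF weight w] T_p by (rule order_trans)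
      moreover have "0 \<le> M * 2 ^ n"
        using M(1) by simp
      ultimately show ?thesis
        using norm_ge_zero[of "T p 0"] by (simp del: norm_ge_zero)
    qed
    also have "\<dots> \<le> M * 2 ^ (m + 2)"
      using M(1) j by (intro mult_left_mono power_increasing) (auto simp: n_def)
    finally have "\<mu> w * cmod (coef j w) * fact n \<le> M * 2 ^ (m + 2)" .
    moreover have "\<mu> w * cmod (coef j w) * 1 \<le> \<mu> w * cmod (coef j w) * fact n"
      using weight_pos[OF w] fact_ge_1[of n, where 'a = real] by (intro mult_left_mono) auto
    ultimately show "\<mu> w * cmod (coef j w) \<le> M * 2 ^ (m + 2)"
      by linarith
  qed (use M in auto)
qed


subsection \<open>Dilations give compact approximants\<close>

lemma linear_T_dilate:
  assumes "0 \<le> r" "r < 1"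
  shows "linear_op Hinf (bloch \<mu>) (\<lambda>f. T (dilate r f))"
proof -
  have "dilate r (\<lambda>z. f z + g z) = (\<lambda>z. dilate r f z + dilate r g z)"
    "dilate r (\<lambda>z. c * f z) = (\<lambda>z. c * dilate r f z)" for f g c
    by (auto simp: dilate_def)
  then show ?thesis
    using linear_T dilate_of_Hinf[OF _ assms] unfolding linear_op_def by simp
qed

text \<open>Montel's theorem extracts from a sequence in the unit ball a subsequence converging
  uniformly on \<open>cball 0 r\<close>. Hence the dilates converge uniformly on the whole disc, and
  boundedness of \<open>T\<close> turns this into convergence in the Bloch norm. The
  Bolzano-Weierstrass property then gives compactness of the closure.\<close>

lemma compact_T_dilate:
  assumes r: "0 \<le> r" "r < 1"
  shows "compact_op Hinf Hinf_norm (bloch \<mu>) (bloch_norm \<mu>) (\<lambda>f. T (dilate r f))"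
proof -
  let ?d = "norm_dist (bloch_norm \<mu>)"
  let ?B = "{f \<in> Hinf. Hinf_norm f \<le> 1}"
  let ?S = "(\<lambda>f. T (dilate r f)) ` ?B"
  interpret B: Metric_space "bloch \<mu>" ?d
    by (rule Metric_space_bloch[OF weight])
  have S: "?S \<subseteq> bloch \<mu>"
    using T_bloch dilate_of_Hinf[OF _ r] by blast
  obtain M where M: "0 \<le> M" "\<And>f c. f \<in> Hinf \<Longrightarrow> (\<And>z. z \<in> unit_disc \<Longrightarrow> cmod (f z) \<le> c) \<Longrightarrow>
      bloch_norm \<mu> (T f) \<le> ennreal (M * c)"
    using T_bound by blast
  have "\<exists>l s. l \<in> bloch \<mu> \<and> strict_mono s \<and> limitin B.mtopology (\<sigma> \<circ> s) l sequentially"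
    if \<sigma>: "range \<sigma> \<subseteq> ?S" for \<sigma> :: "nat \<Rightarrow> complex \<Rightarrow> complex"
  proof -
    have "\<forall>k. \<exists>f. f \<in> ?B \<and> \<sigma> k = T (dilate r f)"
      using \<sigma> by blast
    then obtain f where f: "\<And>k. f k \<in> ?B" "\<And>k. \<sigma> k = T (dilate r (f k))"
      by metis
    have f_le: "cmod (f k z) \<le> 1" if "z \<in> unit_disc" for k z
      using f(1)[of k] that by (auto intro: Hinf_normD)
    obtain g s where g: "g holomorphic_on unit_disc" and s: "strict_mono (s :: nat \<Rightarrow> nat)"
      and pt: "\<And>x. x \<in> unit_disc \<Longrightarrow> (\<lambda>n. f (s n) x) \<longlonglongrightarrow> g x"
      and unif: "\<And>K. compact K \<Longrightarrow> K \<subseteq> unit_disc \<Longrightarrow> uniform_limit K (f \<circ> s) g sequentially"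
    proof (rule Montel[of unit_disc ?B f])
      show "h holomorphic_on unit_disc" if "h \<in> ?B" for h
        using that Hinf_holomorphic by blast
      show "\<exists>b. \<forall>h\<in>?B. \<forall>z\<in>K. cmod (h z) \<le> b" if "compact K" "K \<subseteq> unit_disc" for K
        using that Hinf_normD by blast
      show "range f \<subseteq> ?B"
        using f(1) by blast
    qed auto
    have g_le: "cmod (g z) \<le> 1" if "z \<in> unit_disc" for z
      using Lim_norm_ubound[OF _ pt[OF that], of 1] f_le[OF that] by simp
    \<comment> \<open>The limit \<open>g\<close> is controlled only inside the disc; its dilate is
      cut off to 0 outside and therefore belongs to \<open>Hinf\<close>.\<close>
    have Kg: "dilate r g \<in> Hinf"
      by (rule dilate_Hinf[OF g g_le r])
    have "limitin B.mtopology (\<sigma> \<circ> s) (T (dilate r g)) sequentially"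
      unfolding B.limit_metric_sequentially
    proof (intro conjI allI impI)
      show "T (dilate r g) \<in> bloch \<mu>"
        by (rule T_bloch[OF Kg])
      fix \<epsilon> :: real assume "\<epsilon> > 0"
      \<comment> \<open>Dividing by \<open>M + 1\<close> gives
        \<open>M * \<eta> < \<epsilon>\<close> even when \<open>M = 0\<close>.\<close>
      define \<eta> where "\<eta> = \<epsilon> / (M + 1)"
      have \<eta>: "\<eta> > 0" "M * \<eta> < \<epsilon>"
        using M(1) \<open>\<epsilon> > 0\<close> by (auto simp: \<eta>_def field_simps)
      have "uniform_limit (cball 0 r) (f \<circ> s) g sequentially"
        using r by (intro unif) auto
      then obtain N where N: "\<And>n z. n \<ge> N \<Longrightarrow> z \<in> cball 0 r \<Longrightarrow> dist (f (s n) z) (g z) < \<eta>"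
        using \<eta>(1) unfolding uniform_limit_iff eventually_sequentially by (metis comp_apply)
      have "(\<sigma> \<circ> s) n \<in> bloch \<mu> \<and> ?d ((\<sigma> \<circ> s) n) (T (dilate r g)) < \<epsilon>" if "n \<ge> N" for n
      proof
        show "(\<sigma> \<circ> s) n \<in> bloch \<mu>"
          using \<sigma> S by auto
        have Kf: "dilate r (f (s n)) \<in> Hinf"
          using f(1) dilate_of_Hinf[OF _ r] by blast
        have "cmod (dilate r (f (s n)) z - dilate r g z) \<le> \<eta>" if z: "z \<in> unit_disc" for z
          using N[OF \<open>n \<ge> N\<close>, of "of_real r * z"] dilate_in_disc(2)[OF r z] z
          by (simp add: dilate_def dist_norm less_imp_le)
        then have "bloch_norm \<mu> (T (\<lambda>z. dilate r (f (s n)) z - dilate r g z)) \<le> ennreal (M * \<eta>)"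
          by (rule M(2)[OF Hinf_diff[OF Kf Kg]])
        then have "enn2real (bloch_norm \<mu> (\<lambda>z. T (dilate r (f (s n))) z - T (dilate r g) z)) \<le> M * \<eta>"
          unfolding linear_op_diff[OF linear_T Kf Kg] using M(1) \<eta>(1) by (intro enn2real_leI) auto
        then show "?d ((\<sigma> \<circ> s) n) (T (dilate r g)) < \<epsilon>"
          using \<eta>(2) by (simp add: norm_dist_def f(2))
      qed
      then show "\<exists>N. \<forall>n\<ge>N. (\<sigma> \<circ> s) n \<in> bloch \<mu> \<and> ?d ((\<sigma> \<circ> s) n) (T (dilate r g)) < \<epsilon>"
        by blast
    qed
    then show ?thesis
      using T_bloch[OF Kg] s by blast
  qed
  then have "\<forall>R. R \<subseteq> ?S \<and> infinite R \<longrightarrow> bloch \<mu> \<inter> B.mtopology derived_set_of R \<noteq> {}"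
    using B.Bolzano_Weierstrass_property[OF S S] by blast
  then have "compactin B.mtopology (B.mtopology closure_of ?S)"
    unfolding B.compact_closure_of_eq_Bolzano_Weierstrass by blast
  then show ?thesis
    using linear_T_dilate[OF r] by (simp add: compact_op_def)
qed

abbreviation ess_norm_T :: ennreal
  where "ess_norm_T \<equiv> ess_norm Hinf Hinf_norm (bloch \<mu>) (bloch_norm \<mu>) T"

text \<open>With \<open>g = f - dilate r f\<close>, the value of \<open>T g\<close> at 0 and the
  points where \<open>cmod (\<phi> z) \<le> \<delta>\<close> contribute multiples of
  \<open>1 - r\<close>, which \<open>r\<close> close to 1 absorbs into \<open>e\<close>. The
  remaining points contribute the right-hand side, whose factor 2 is the bound on
  \<open>g\<close>.\<close>

lemma ess_norm_le_bdry_SUP: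
  assumes \<delta>: "0 \<le> \<delta>" "\<delta> < 1"
  shows "ess_norm_T \<le> (\<Sum>j<3. ennreal (2 * fact (m + j) * 4 ^ (m + j)) * bdry_SUP \<phi> (coef_ratio j) \<delta>)"
    (is "_ \<le> ?R")
proof (rule ennreal_le_epsilon)
  fix e :: real assume e: "e > 0"
  \<comment> \<open>Enlarging \<delta> to include \<open>\<phi> 0\<close> also makes the term
    \<open>cmod (T g 0)\<close> of the Bloch norm small.\<close>
  define \<delta>' where "\<delta>' = max \<delta> (cmod (\<phi> 0))"
  have \<delta>': "0 \<le> \<delta>'" "\<delta>' < 1"
    using \<delta> \<phi>_in_disc[of 0] by (auto simp: \<delta>'_def)
  have "\<exists>C\<ge>0. \<forall>r f w. 0 \<le> r \<longrightarrow> r < 1 \<longrightarrow> f holomorphic_on unit_disc \<longrightarrow>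
      (\<forall>z\<in>unit_disc. cmod (f z) \<le> 1) \<longrightarrow> cmod w \<le> \<delta>' \<longrightarrow>
      cmod ((deriv ^^ k) (\<lambda>z. f z - dilate r f z) w) \<le> C * (1 - r)" for k
    by (rule dilate_error_higher_deriv[OF \<delta>', of k]) blast
  then obtain C where C: "\<And>k. 0 \<le> C k" "\<And>k r f w. 0 \<le> r \<Longrightarrow> r < 1 \<Longrightarrow> f holomorphic_on unit_disc \<Longrightarrow>
      (\<And>z. z \<in> unit_disc \<Longrightarrow> cmod (f z) \<le> 1) \<Longrightarrow> cmod w \<le> \<delta>' \<Longrightarrow>
      cmod ((deriv ^^ k) (\<lambda>z. f z - dilate r f z) w) \<le> C k * (1 - r)"
    by metis
  obtain M where M: "0 \<le> M" "\<And>z j. z \<in> unit_disc \<Longrightarrow> j < 3 \<Longrightarrow> \<mu> z * cmod (coef j z) \<le> M"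
    using coef_bound by blast
  \<comment> \<open>Multiplied by \<open>1 - r\<close>, \<open>E0\<close> bounds the value of
    \<open>T g\<close> at 0 and \<open>E1\<close> the weighted derivative where
    \<open>cmod (\<phi> z) \<le> \<delta>\<close>.\<close>
  define E0 where "E0 = cmod (\<psi>\<^sub>1 0) * C m + cmod (\<psi>\<^sub>2 0) * C (m + 1)"
  define E1 where "E1 = (\<Sum>j<3. M * C (m + j))"
  have E: "0 \<le> E0" "0 \<le> E1"
    using C(1) M(1) by (auto simp: E0_def E1_def intro!: add_nonneg_nonneg mult_nonneg_nonneg sum_nonneg)
  \<comment> \<open>Chosen so that the total error \<open>(E0 + E1) * (1 - r)\<close> is at most
    \<open>e\<close>; adding 1 keeps the denominator positive, and the maximum keeps
    \<open>r\<close> nonnegative for large \<open>e\<close>.\<close>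
  define r where "r = max 0 (1 - e / (E0 + E1 + 1))"
  have r: "0 \<le> r" "r < 1"
    using e E by (auto simp: r_def)
  have "(E0 + E1) * (1 - r) \<le> (E0 + E1 + 1) * (1 - r)"
    using r by (intro mult_right_mono) auto
  also have "\<dots> \<le> (E0 + E1 + 1) * (e / (E0 + E1 + 1))"
    using E by (intro mult_left_mono) (auto simp: r_def)
  also have "\<dots> = e"
    using E by simp
  finally have Er: "E0 * (1 - r) + E1 * (1 - r) \<le> e"
    by (simp add: algebra_simps)
  have "op_norm Hinf Hinf_norm (bloch_norm \<mu>) (\<lambda>f z. T f z - T (dilate r f) z) \<le> ?R + ennreal e"
    unfolding op_norm_def
  proof (rule SUP_least)
    fix f assume "f \<in> {f \<in> Hinf. Hinf_norm f \<le> 1}"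
    then have f: "f \<in> Hinf" "f holomorphic_on unit_disc" "\<And>z. z \<in> unit_disc \<Longrightarrow> cmod (f z) \<le> 1"
      using Hinf_normD Hinf_holomorphic by auto
    define g where "g = (\<lambda>z. f z - dilate r f z)"
    have Kf: "dilate r f \<in> Hinf"
      by (rule dilate_of_Hinf[OF f(1) r])
    have g_hol: "g holomorphic_on unit_disc"
      unfolding g_def by (rule Hinf_holomorphic[OF Hinf_diff[OF f(1) Kf]])
    have g_near: "cmod ((deriv ^^ k) g w) \<le> C k * (1 - r)" if "cmod w \<le> \<delta>'" for k w
      unfolding g_def by (rule C(2)[OF r f(2,3) that])
    have g_le: "cmod (g z) \<le> 2" if z: "z \<in> unit_disc" for z
    proof -
      have "cmod (dilate r f z) \<le> 1"
        using z f(3)[OF dilate_in_disc(1)[OF r z]] by (simp only: dilate_def if_True)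
      then show ?thesis
        using f(3)[OF z] norm_triangle_ineq4[of "f z" "dilate r f z"] by (simp add: g_def)
    qed
    have "cmod (T g 0) \<le> cmod (\<psi>\<^sub>1 0) * cmod ((deriv ^^ m) g (\<phi> 0)) + cmod (\<psi>\<^sub>2 0) * cmod ((deriv ^^ (m + 1)) g (\<phi> 0))"
      unfolding T_op_def norm_mult[symmetric] by (simp add: norm_triangle_ineq del: funpow.simps)
    also have "\<dots> \<le> cmod (\<psi>\<^sub>1 0) * (C m * (1 - r)) + cmod (\<psi>\<^sub>2 0) * (C (m + 1) * (1 - r))"
      by (intro add_mono mult_left_mono g_near) (auto simp: \<delta>'_def)
    also have "\<dots> = E0 * (1 - r)"
      by (simp add: E0_def algebra_simps)
    finally have T0: "cmod (T g 0) \<le> E0 * (1 - r)" .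
    have "ennreal (\<mu> z * cmod (deriv (T g) z)) \<le> ennreal (E1 * (1 - r)) + ?R" if z: "z \<in> unit_disc" for z
    proof -
      have "cmod (deriv (T g) z) \<le> (\<Sum>j<3. cmod (coef j z) * cmod ((deriv ^^ (m + j)) g (\<phi> z)))"
        unfolding deriv_T[OF g_hol z] by (rule order_trans[OF norm_sum]) (simp add: norm_mult)
      then have "\<mu> z * cmod (deriv (T g) z) \<le>
          \<mu> z * (\<Sum>j<3. cmod (coef j z) * cmod ((deriv ^^ (m + j)) g (\<phi> z)))"
        using weight_pos[OF z] by (intro mult_left_mono) auto
      also have "\<dots> = (\<Sum>j<3. \<mu> z * cmod (coef j z) * cmod ((deriv ^^ (m + j)) g (\<phi> z)))"
        by (simp add: sum_distrib_left mult.assoc)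
      finally have *: "\<mu> z * cmod (deriv (T g) z) \<le> \<dots>" .
      show ?thesis
      \<comment> \<open>On the inner part the weighted coefficients are bounded by \<open>M\<close>
        and the derivatives of \<open>g\<close> are small. On the outer part Cauchy's estimate with
        the bound 2 on \<open>g\<close> produces the ratios.\<close>
      proof (cases "cmod (\<phi> z) \<le> \<delta>")
        case True
        have "(\<Sum>j<3. \<mu> z * cmod (coef j z) * cmod ((deriv ^^ (m + j)) g (\<phi> z))) \<le>
            (\<Sum>j<3. M * (C (m + j) * (1 - r)))"
          using True M z by (intro sum_mono mult_mono g_near) (auto simp: \<delta>'_def)
        also have "\<dots> = E1 * (1 - r)"
          by (simp add: E1_def sum_distrib_right mult.assoc)
        finally have "ennreal (\<mu> z * cmod (deriv (T g) z)) \<le> ennreal (E1 * (1 - r))"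
          using * by (intro ennreal_leI) linarith
        then show ?thesis
          by (rule order_trans) simp
      next
        case False
        have \<mu>: "0 \<le> \<mu> z"
          using weight_pos[OF z] by simp
        have \<phi>1: "0 \<le> 1 - (cmod (\<phi> z))\<^sup>2"
          using \<phi>_in_disc[OF z] by (simp add: power_le_one)
        have "ennreal (\<mu> z * cmod (deriv (T g) z)) \<le>
            ennreal (\<Sum>j<3. \<mu> z * cmod (coef j z) * cmod ((deriv ^^ (m + j)) g (\<phi> z)))"
          using * by (rule ennreal_leI)
        also have "\<dots> = (\<Sum>j<3. ennreal (\<mu> z * cmod (coef j z) * cmod ((deriv ^^ (m + j)) g (\<phi> z))))"
          using \<mu> by (intro sum_ennreal[symmetric]) simp
        also have "\<dots> \<le> ?R"
        proof (rule sum_mono)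
          fix j
          have "\<mu> z * cmod (coef j z) * cmod ((deriv ^^ (m + j)) g (\<phi> z)) \<le>
              \<mu> z * cmod (coef j z) * (fact (m + j) * 4 ^ (m + j) * 2 / (1 - (cmod (\<phi> z))\<^sup>2) ^ (m + j))"
            using higher_deriv_bound_disc[OF g_hol g_le \<phi>_in_disc[OF z]] \<mu> by (intro mult_left_mono) auto
          also have "\<dots> = (2 * fact (m + j) * 4 ^ (m + j)) * (\<mu> z * cmod (coef j z) / (1 - (cmod (\<phi> z))\<^sup>2) ^ (m + j))"
            by simp
          finally have "ennreal (\<mu> z * cmod (coef j z) * cmod ((deriv ^^ (m + j)) g (\<phi> z))) \<le>
              ennreal (2 * fact (m + j) * 4 ^ (m + j)) * coef_ratio j z"
            unfolding coef_ratio_def by (subst ennreal_mult'[symmetric]) (auto intro!: ennreal_leI)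
          also have "\<dots> \<le> ennreal (2 * fact (m + j) * 4 ^ (m + j)) * bdry_SUP \<phi> (coef_ratio j) \<delta>"
            using z False by (intro mult_left_mono bdry_SUP_upper) auto
          finally show "ennreal (\<mu> z * cmod (coef j z) * cmod ((deriv ^^ (m + j)) g (\<phi> z))) \<le> \<dots>" .
        qed
        finally show ?thesis
          by (rule order_trans) simp
      qed
    qed
    then have "bloch_norm \<mu> (T g) \<le> ennreal (E0 * (1 - r)) + (ennreal (E1 * (1 - r)) + ?R)"
      by (intro bloch_norm_le T0)
    also have "\<dots> = ?R + ennreal (E0 * (1 - r) + E1 * (1 - r))"
      using E r by (subst ennreal_plus) (auto simp: ac_simps)
    also have "\<dots> \<le> ?R + ennreal e"
      using Er by (intro add_left_mono ennreal_leI)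
    finally show "bloch_norm \<mu> (\<lambda>z. T f z - T (dilate r f) z) \<le> ?R + ennreal e"
      by (simp only: g_def linear_op_diff[OF linear_T f(1) Kf])
  qed
  moreover have "(\<lambda>f. T (dilate r f)) \<in> {L. compact_op Hinf Hinf_norm (bloch \<mu>) (bloch_norm \<mu>) L}"
    using compact_T_dilate[OF r] by blast
  ultimately show "ess_norm_T \<le> ?R + ennreal e"
    unfolding ess_norm_def by (meson INF_lower order_trans)
qed


subsection \<open>Lower bound for the essential norm\<close>

abbreviation test_norm :: "nat \<Rightarrow> complex \<Rightarrow> ennreal"
  where "test_norm i w \<equiv> bloch_norm \<mu> (T (test_fun i (\<phi> w)))"

text \<open>For fixed \<open>z\<close> both expressions are finite combinations, with fixed
  coefficients, of derivatives of the test functions at the fixed point \<open>\<phi> z\<close>, and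
  each of these tends to 0.\<close>

lemma T_test_fun_tendsto_0:
  assumes w: "\<And>l. w l \<in> unit_disc" "(\<lambda>l. cmod (\<phi> (w l))) \<longlonglongrightarrow> 1" and "1 \<le> i" and z: "z \<in> unit_disc"
  shows "(\<lambda>l. T (test_fun i (\<phi> (w l))) z) \<longlonglongrightarrow> 0"
    and "(\<lambda>l. deriv (T (test_fun i (\<phi> (w l)))) z) \<longlonglongrightarrow> 0"
proof -
  have *: "(\<lambda>l. (deriv ^^ k) (test_fun i (\<phi> (w l))) (\<phi> z)) \<longlonglongrightarrow> 0" for k
    by (intro higher_deriv_test_fun_tendsto_0 \<open>1 \<le> i\<close> \<phi>_in_disc w z)
  show "(\<lambda>l. T (test_fun i (\<phi> (w l))) z) \<longlonglongrightarrow> 0"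
    using z tendsto_add[OF tendsto_mult_right_zero[OF *] tendsto_mult_right_zero[OF *], of "\<psi>\<^sub>1 z" m "\<psi>\<^sub>2 z" "m + 1"]
    by (simp add: T_op_def del: funpow.simps)
  have "(\<lambda>l. \<Sum>j<3. coef j z * (deriv ^^ (m + j)) (test_fun i (\<phi> (w l))) (\<phi> z)) \<longlonglongrightarrow> 0"
    by (intro tendsto_null_sum tendsto_mult_right_zero *)
  then show "(\<lambda>l. deriv (T (test_fun i (\<phi> (w l)))) z) \<longlonglongrightarrow> 0"
    by (simp only: deriv_T[OF test_fun_holomorphic[OF \<phi>_in_disc[OF w(1)]] z])
qed

text \<open>The test functions need not be weakly null in \<open>H\<^sup>\<infinity>\<close>, so a compact \<open>L\<close> need not send them to
  zero. But \<open>L\<close> sends a subsequence to a Cauchy sequence, so \<open>T - L\<close> almost agrees with \<open>T\<close> on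
  differences \<open>f\<^sub>k - f\<^sub>l\<close>; letting \<open>l\<close> tend to infinity removes \<open>T f\<^sub>l\<close> pointwise.\<close>

lemma limsup_test_norm_le_op_norm:
  assumes L: "compact_op Hinf Hinf_norm (bloch \<mu>) (bloch_norm \<mu>) L" and "1 \<le> i"
  shows "limsup_to_bdry \<phi> (test_norm i) \<le>
    2 * op_norm Hinf Hinf_norm (bloch_norm \<mu>) (\<lambda>f z. T f z - L f z)"
    (is "_ \<le> 2 * ?N")
proof (rule dense_ge)
  fix c' assume "2 * ?N < c'"
  show "limsup_to_bdry \<phi> (test_norm i) \<le> c'"
  proof (rule ccontr)
    assume "\<not> limsup_to_bdry \<phi> (test_norm i) \<le> c'"
    then have c': "c' < (INF \<delta>\<in>{..<1}. bdry_SUP \<phi> (test_norm i) \<delta>)"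
      by (simp add: limsup_to_bdry_eq_INF[OF \<phi>_disc])
    \<comment> \<open>As \<open>c'\<close> lies strictly below the limit superior, every
      neighbourhood of the boundary contains a value \<open>\<phi> w\<close> whose test function has
      image norm above \<open>c'\<close>.\<close>
    have "\<exists>w\<in>unit_disc. \<delta> < cmod (\<phi> w) \<and> c' < test_norm i w" if "\<delta> < 1" for \<delta>
    proof -
      have "c' < bdry_SUP \<phi> (test_norm i) \<delta>"
        using c' that by (auto intro: less_le_trans INF_lower)
      then show ?thesis
        by (auto simp: bdry_SUP_def less_SUP_iff)
    qed
    then have "\<forall>k. \<exists>w\<in>unit_disc. 1 - inverse (real (Suc k)) < cmod (\<phi> w) \<and> c' < test_norm i w"
      by simp
    then obtain w where w: "\<And>k. w k \<in> unit_disc" "\<And>k. 1 - inverse (real (Suc k)) < cmod (\<phi> (w k))"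
        "\<And>k. c' < test_norm i (w k)"
      by metis
    have "(\<lambda>k. cmod (\<phi> (w k))) \<longlonglongrightarrow> 1"
    proof (rule tendsto_sandwich)
      show "(\<lambda>k. 1 - inverse (real (Suc k))) \<longlonglongrightarrow> 1"
        using tendsto_diff[OF tendsto_const LIMSEQ_inverse_real_of_nat, of 1] by simp
      show "\<forall>\<^sub>F k in sequentially. 1 - inverse (real (Suc k)) \<le> cmod (\<phi> (w k))"
        using w(2) by (simp add: less_imp_le)
      show "\<forall>\<^sub>F k in sequentially. cmod (\<phi> (w k)) \<le> 1"
        using \<phi>_in_disc[OF w(1)] by (simp add: less_imp_le)
    qed simp
    note lim_w = this
    define f where "f k = test_fun i (\<phi> (w k))" for k
    have f: "f k \<in> Hinf" "Hinf_norm (f k) \<le> 1" for k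
      unfolding f_def by (intro test_fun_Hinf \<phi>_in_disc w(1))+
    interpret B: Metric_space "bloch \<mu>" "norm_dist (bloch_norm \<mu>)"
      by (rule Metric_space_bloch[OF weight])
    let ?S = "L ` {f \<in> Hinf. Hinf_norm f \<le> 1}"
    have lin_L: "linear_op Hinf (bloch \<mu>) L" and comp: "compactin B.mtopology (B.mtopology closure_of ?S)"
      using L by (auto simp: compact_op_def Let_def)
    have L_bloch: "L h \<in> bloch \<mu>" if "h \<in> Hinf" for h
      using lin_L that unfolding linear_op_def by blast
    have "?S \<subseteq> B.mtopology closure_of ?S"
      using L_bloch by (intro closure_of_subset) auto
    then have "range (\<lambda>k. L (f k)) \<subseteq> B.mtopology closure_of ?S"
      using f by blast
    then obtain y s where s: "strict_mono s"
      and lim: "limitin B.mtopology ((\<lambda>k. L (f k)) \<circ> s) y sequentially"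
      using comp unfolding B.compactin_sequentially by meson
    have y: "y \<in> bloch \<mu>"
      using lim by (simp add: B.limit_metric_sequentially)
    have eps: "c' \<le> 2 * ?N + ennreal e" if e: "e > 0" for e
    proof -
      obtain K where K: "\<And>k. k \<ge> K \<Longrightarrow> norm_dist (bloch_norm \<mu>) (L (f (s k))) y < e / 2"
        using lim e unfolding B.limit_metric_sequentially by (metis comp_apply half_gt_zero)
      have Ly: "bloch_norm \<mu> (\<lambda>z. L (f (s k)) z - y z) \<le> ennreal (e / 2)" if "k \<ge> K" for k
      proof -
        have "bloch_norm \<mu> (\<lambda>z. L (f (s k)) z - y z) < \<infinity>"
          using bloch_diff[OF weight L_bloch[OF f(1)] y] by (simp add: bloch_def)
        then obtain x where x: "0 \<le> x" "bloch_norm \<mu> (\<lambda>z. L (f (s k)) z - y z) = ennreal x"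
          by (auto simp: less_top_ennreal)
        then show ?thesis
          using K[OF that] by (simp add: norm_dist_def ennreal_leI)
      qed
      have TL: "bloch_norm \<mu> (\<lambda>z. T (f k) z - L (f k) z) \<le> ?N" for k
        unfolding op_norm_def using f by (intro SUP_upper) auto
      \<comment> \<open>All late images \<open>T (f (s k))\<close> lie within
        \<open>?N + e / 2\<close> of the single function \<open>y\<close>; comparing two of them
        produces the factor 2.\<close>
      have TLy: "bloch_norm \<mu> (\<lambda>z. T (f (s k)) z - y z) \<le> ?N + ennreal (e / 2)" if "k \<ge> K" for k
        by (rule order_trans[OF bloch_norm_triangle[OF weight T_bloch[OF f(1)] L_bloch[OF f(1)] y]
              add_mono[OF TL Ly[OF that]]])
      have TT: "bloch_norm \<mu> (\<lambda>z. T (f (s K)) z - T (f (s l)) z) \<le> 2 * ?N + ennreal e" if l: "l \<ge> K" for l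
      proof -
        have "bloch_norm \<mu> (\<lambda>z. T (f (s K)) z - T (f (s l)) z) \<le>
            bloch_norm \<mu> (\<lambda>z. T (f (s K)) z - y z) + bloch_norm \<mu> (\<lambda>z. y z - T (f (s l)) z)"
          by (intro bloch_norm_triangle weight T_bloch f y)
        also have "bloch_norm \<mu> (\<lambda>z. y z - T (f (s l)) z) = bloch_norm \<mu> (\<lambda>z. T (f (s l)) z - y z)"
          by (intro bloch_norm_minus_commute weight bloch_holomorphic[of _ \<mu>] T_bloch f y)
        also have "bloch_norm \<mu> (\<lambda>z. T (f (s K)) z - y z) + \<dots> \<le> (?N + ennreal (e / 2)) + (?N + ennreal (e / 2))"
          by (intro add_mono TLy l order_refl)
        also have "\<dots> = 2 * ?N + (ennreal (e / 2) + ennreal (e / 2))"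
          by (simp add: mult_2 ac_simps)
        also have "ennreal (e / 2) + ennreal (e / 2) = ennreal e"
          using e by (simp flip: ennreal_plus)
        finally show ?thesis .
      qed
      \<comment> \<open>With \<open>K\<close> and \<open>z\<close> fixed and \<open>l\<close>
        tending to infinity, the pointwise contributions of \<open>T (f (s l))\<close> vanish, so
        the bound on the difference passes to \<open>T (f (s K))\<close> alone. The supremum over
        \<open>z\<close> is taken only afterwards.\<close>
      have "ennreal (cmod (T (f (s K)) 0) + \<mu> z * cmod (deriv (T (f (s K))) z)) \<le> 2 * ?N + ennreal e"
        if z: "z \<in> unit_disc" for z
      proof (rule LIMSEQ_le_const2)
        have sw: "\<And>l. (w \<circ> s) l \<in> unit_disc" "(\<lambda>l. cmod (\<phi> ((w \<circ> s) l))) \<longlonglongrightarrow> 1"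
          using w(1) LIMSEQ_subseq_LIMSEQ[OF lim_w s] by (auto simp: o_def)
        have z0: "0 \<in> unit_disc"
          by simp
        have "(\<lambda>l. cmod (T (f (s K)) 0 - T (f (s l)) 0) +
            \<mu> z * cmod (deriv (T (f (s K))) z - deriv (T (f (s l))) z)) \<longlonglongrightarrow>
            cmod (T (f (s K)) 0 - 0) + \<mu> z * cmod (deriv (T (f (s K))) z - 0)"
          using T_test_fun_tendsto_0(1)[OF sw \<open>1 \<le> i\<close> z0] T_test_fun_tendsto_0(2)[OF sw \<open>1 \<le> i\<close> z]
          by (intro tendsto_intros) (auto simp: f_def)
        then show "(\<lambda>l. ennreal (cmod (T (f (s K)) 0 - T (f (s l)) 0) +
            \<mu> z * cmod (deriv (T (f (s K))) z - deriv (T (f (s l))) z))) \<longlonglongrightarrow>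
            ennreal (cmod (T (f (s K)) 0) + \<mu> z * cmod (deriv (T (f (s K))) z))"
          by (intro tendsto_ennrealI) simp
        have D: "deriv (\<lambda>z. T (f (s K)) z - T (f (s l)) z) z = deriv (T (f (s K))) z - deriv (T (f (s l))) z" for l
          by (intro deriv_diff holomorphic_disc_differentiable bloch_holomorphic[of _ \<mu>] T_bloch f z)
        have le: "ennreal (cmod (T (f (s K)) 0 - T (f (s l)) 0) +
            \<mu> z * cmod (deriv (T (f (s K))) z - deriv (T (f (s l))) z)) \<le> 2 * ?N + ennreal e" if "l \<ge> K" for l
          using bloch_norm_ge_pointwise[OF weight z, of "\<lambda>z. T (f (s K)) z - T (f (s l)) z"]
            TT[OF that] unfolding D by (rule order_trans)
        show "\<exists>N. \<forall>l\<ge>N. ennreal (cmod (T (f (s K)) 0 - T (f (s l)) 0) +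
            \<mu> z * cmod (deriv (T (f (s K))) z - deriv (T (f (s l))) z)) \<le> 2 * ?N + ennreal e"
          by (intro exI[of _ K] allI impI le)
      qed
      then have "bloch_norm \<mu> (T (f (s K))) \<le> 2 * ?N + ennreal e"
        unfolding bloch_norm_eq_SUP[OF weight, of "T (f (s K))"] by (rule SUP_least)
      then show "c' \<le> 2 * ?N + ennreal e"
        using w(3)[of "s K"] by (simp add: f_def)
    qed
    have "c' \<le> 2 * ?N"
      by (rule ennreal_le_epsilon[OF eps])
    with \<open>2 * ?N < c'\<close> show False
      by simp
  qed
qed

lemma limsup_test_norm_le_ess_norm:
  assumes "1 \<le> i"
  shows "limsup_to_bdry \<phi> (test_norm i) \<le> 2 * ess_norm_T"
proof -
  \<comment> \<open>Moving the factor 2 to the left as 1/2 turns the estimate for each compact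
    \<open>L\<close> into a lower bound for the infimum defining the essential norm.\<close>
  have half: "ennreal (1/2) * (2 * x) = x" "2 * (ennreal (1/2) * x) = x" for x
  proof -
    have "ennreal (1/2) * ennreal 2 = 1"
      by (subst ennreal_mult[symmetric]) auto
    then have "ennreal (1/2) * 2 = 1"
      by simp
    then show "ennreal (1/2) * (2 * x) = x" "2 * (ennreal (1/2) * x) = x"
      by (metis mult.assoc mult.commute mult_1)+
  qed
  have "ennreal (1/2) * limsup_to_bdry \<phi> (test_norm i) \<le> ess_norm_T"
    unfolding ess_norm_def
  proof (rule INF_greatest)
    fix L assume "L \<in> {L. compact_op Hinf Hinf_norm (bloch \<mu>) (bloch_norm \<mu>) L}"
    then have "ennreal (1/2) * limsup_to_bdry \<phi> (test_norm i) \<le>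
        ennreal (1/2) * (2 * op_norm Hinf Hinf_norm (bloch_norm \<mu>) (\<lambda>f z. T f z - L f z))"
      using assms by (intro mult_left_mono limsup_test_norm_le_op_norm) auto
    then show "ennreal (1/2) * limsup_to_bdry \<phi> (test_norm i) \<le>
        op_norm Hinf Hinf_norm (bloch_norm \<mu>) (\<lambda>f z. T f z - L f z)"
      by (simp only: half)
  qed
  then have "2 * (ennreal (1/2) * limsup_to_bdry \<phi> (test_norm i)) \<le> 2 * ess_norm_T"
    by (rule mult_left_mono) simp
  then show ?thesis
    by (simp only: half)
qed

subsection \<open>The coefficients are controlled by the test functions\<close>

text \<open>At the centre \<open>a = \<phi> w\<close> the factor
  \<open>((1 - cmod a) / q) ^ i\<close> equals \<open>(1 + cmod a) ^ -i\<close>, so up to a factor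
  of at most \<open>2 ^ 3 = 8\<close> the weighted derivatives for \<open>i = 1, 2, 3\<close> are
  rows of the rising factorial matrix applied to the ratios, and inverting it recovers each
  ratio.\<close>

lemma coef_ratio_le_test_norm:
  assumes w: "w \<in> unit_disc" "1/2 \<le> cmod (\<phi> w)" and j: "j < 3"
  shows "coef_ratio j w \<le> ennreal (2 ^ (m + 2) * (inversion_const m * 8)) * (\<Sum>i\<in>{1..3}. test_norm i w)"
proof -
  define a where "a = \<phi> w"
  have a: "a \<in> unit_disc" "1/2 \<le> cmod a" "cmod a < 1"
    using \<phi>_in_disc[OF w(1)] w(2) by (auto simp: a_def)
  have \<mu>: "0 < \<mu> w"
    by (rule weight_pos[OF w(1)])
  define q where "q = 1 - (cmod a)\<^sup>2"
  have q: "q = (1 - cmod a) * (1 + cmod a)" "0 < q"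
  proof -
    show *: "q = (1 - cmod a) * (1 + cmod a)"
      by (simp add: q_def power2_eq_square algebra_simps)
    show "0 < q"
      unfolding * using a by (intro mult_pos_pos) auto
  qed
  have qa: "1 - cnj a * a = of_real q"
    by (simp add: q_def mult.commute[of "cnj a"] complex_norm_square[symmetric] flip: of_real_power)
  \<comment> \<open>In modulus this is the ratio multiplied by \<open>cmod a ^ (m + j)\<close>; the
    extra power comes from differentiating the test function.\<close>
  define X where "X j = of_real (\<mu> w) * coef j w * cnj a ^ (m + j) / of_real q ^ (m + j)" for j
  define Y where "Y i = (\<Sum>j<3. pochhammer (of_nat i) (m + j) * X j)" for i
  have Y: "cmod (Y i) \<le> 8 * (\<mu> w * cmod (deriv (T (test_fun i a)) w))" if i: "i \<in> {1..3}" for i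
  proof -
    have "of_real (\<mu> w) * deriv (T (test_fun i a)) w =
        (\<Sum>j<3. of_real (\<mu> w) * (coef j w * (pochhammer (of_nat i) (m + j) * cnj a ^ (m + j) *
          of_real (1 - cmod a) ^ i / of_real q ^ (i + (m + j)))))"
      unfolding deriv_T[OF test_fun_holomorphic[OF a(1)] w(1)] a_def[symmetric]
        higher_deriv_test_fun[OF a(1) a(1)] qa sum_distrib_left by simp
    also have "\<dots> = (of_real (1 - cmod a) / of_real q) ^ i * Y i"
      unfolding Y_def X_def sum_distrib_left
      by (intro sum.cong) (auto simp: power_add power_divide)
    also have "of_real (1 - cmod a) / of_real q = (inverse (of_real (1 + cmod a)) :: complex)"
    proof -
      have "(1 - cmod a) / q = inverse (1 + cmod a)"
        using a by (simp add: q(1) divide_simps)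
      then show ?thesis
        by (metis of_real_divide of_real_inverse)
    qed
    finally have *: "of_real (\<mu> w) * deriv (T (test_fun i a)) w = inverse (of_real (1 + cmod a)) ^ i * Y i" .
    have "1 + cmod a \<noteq> 0"
      using a(2) by linarith
    then have "(of_real (1 + cmod a) :: complex) \<noteq> 0"
      unfolding of_real_eq_0_iff .
    then have "Y i = of_real (1 + cmod a) ^ i * (of_real (\<mu> w) * deriv (T (test_fun i a)) w)"
      unfolding * by (simp add: power_inverse)
    then have "cmod (Y i) = (1 + cmod a) ^ i * cmod (of_real (\<mu> w) * deriv (T (test_fun i a)) w)"
      by (simp only: norm_mult norm_power norm_of_real) simp
    also have "\<dots> \<le> 8 * cmod (of_real (\<mu> w) * deriv (T (test_fun i a)) w)"
    proof (rule mult_right_mono)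
      have "(1 + cmod a) ^ i \<le> 2 ^ i"
        using a by (intro power_mono) auto
      also have "\<dots> \<le> 2 ^ 3"
        using i by (intro power_increasing) auto
      finally show "(1 + cmod a) ^ i \<le> 8"
        by simp
    qed simp
    finally show ?thesis
      using \<mu> by (simp add: norm_mult)
  qed
  have ic: "0 \<le> inversion_const m"
    by (simp add: inversion_const_def)
  have "\<mu> w * cmod (coef j w) / q ^ (m + j) \<le> 2 ^ (m + 2) * cmod (X j)"
  proof -
    have "cmod (X j) = \<mu> w * cmod (coef j w) / q ^ (m + j) * cmod a ^ (m + j)"
      using \<mu> q(2) by (simp add: X_def norm_mult norm_divide norm_power)
    \<comment> \<open>The assumption that \<open>cmod (\<phi> w)\<close> is at least 1/2 allows the
      power of \<open>cmod a\<close> to be undone at the cost of \<open>2 ^ (m + 2)\<close>.\<close>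
    moreover have "1 \<le> 2 ^ (m + 2) * cmod a ^ (m + j)"
    proof -
      have "1 \<le> (2 * cmod a) ^ (m + j)"
        using a(2) by (intro one_le_power) simp
      also have "\<dots> \<le> 2 ^ (m + 2) * cmod a ^ (m + j)"
        unfolding power_mult_distrib using j by (intro mult_right_mono power_increasing) auto
      finally show ?thesis .
    qed
    moreover have "0 \<le> \<mu> w * cmod (coef j w) / q ^ (m + j)"
      using \<mu> q(2) by simp
    ultimately show ?thesis
      using mult_left_mono[of 1 "2 ^ (m + 2) * cmod a ^ (m + j)" "\<mu> w * cmod (coef j w) / q ^ (m + j)"]
      by (simp add: mult_ac)
  qed
  also have "\<dots> \<le> 2 ^ (m + 2) * (inversion_const m * (\<Sum>i\<in>{1..3}. cmod (Y i)))"
    unfolding Y_def using j by (intro mult_left_mono pochhammer_matrix_inversion) auto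
  also have "\<dots> \<le> 2 ^ (m + 2) * (inversion_const m * (\<Sum>i\<in>{1..3}. 8 * (\<mu> w * cmod (deriv (T (test_fun i a)) w))))"
    using ic by (intro mult_left_mono sum_mono Y) auto
  also have "\<dots> = 2 ^ (m + 2) * (inversion_const m * 8) * (\<Sum>i\<in>{1..3}. \<mu> w * cmod (deriv (T (test_fun i a)) w))"
    by (simp add: sum_distrib_left mult_ac)
  finally have "coef_ratio j w \<le>
      ennreal (2 ^ (m + 2) * (inversion_const m * 8)) * ennreal (\<Sum>i\<in>{1..3}. \<mu> w * cmod (deriv (T (test_fun i a)) w))"
    unfolding coef_ratio_def a_def[symmetric] q_def[symmetric]
    using ic by (subst ennreal_mult'[symmetric]) (auto intro: ennreal_leI)
  also have "ennreal (\<Sum>i\<in>{1..3}. \<mu> w * cmod (deriv (T (test_fun i a)) w)) =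
      (\<Sum>i\<in>{1..3}. ennreal (\<mu> w * cmod (deriv (T (test_fun i a)) w)))"
    using \<mu> by (intro sum_ennreal[symmetric]) simp
  also have "ennreal (2 ^ (m + 2) * (inversion_const m * 8)) * \<dots> \<le>
      ennreal (2 ^ (m + 2) * (inversion_const m * 8)) * (\<Sum>i\<in>{1..3}. test_norm i w)"
  proof (intro mult_left_mono sum_mono)
    fix i
    have "ennreal (\<mu> w * cmod (deriv (T (test_fun i a)) w)) \<le>
        ennreal (cmod (T (test_fun i a) 0) + \<mu> w * cmod (deriv (T (test_fun i a)) w))"
      by (intro ennreal_leI) simp
    also have "\<dots> \<le> test_norm i w"
      unfolding a_def by (rule bloch_norm_ge_pointwise[OF weight w(1)])
    finally show "ennreal (\<mu> w * cmod (deriv (T (test_fun i a)) w)) \<le> test_norm i w" .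
  qed simp
  finally show ?thesis .
qed

text \<open>The pointwise estimate passes to the suprema once \<open>\<delta> > 1/2\<close>. The
  limit in \<delta> is used instead of the infimum because it commutes with the finite sum over
  \<open>i\<close>.\<close>

lemma limsup_coef_ratio_le:
  assumes j: "j < 3"
  shows "limsup_to_bdry \<phi> (coef_ratio j) \<le>
    ennreal (2 ^ (m + 2) * (inversion_const m * 8)) * (\<Sum>i\<in>{1..3}. limsup_to_bdry \<phi> (test_norm i))"
proof (rule tendsto_le[OF trivial_limit_at_left_real _ bdry_SUP_tendsto[OF \<phi>_disc]])
  show "((\<lambda>\<delta>. ennreal (2 ^ (m + 2) * (inversion_const m * 8)) * (\<Sum>i\<in>{1..3}. bdry_SUP \<phi> (test_norm i) \<delta>)) \<longlongrightarrow>
      ennreal (2 ^ (m + 2) * (inversion_const m * 8)) * (\<Sum>i\<in>{1..3}. limsup_to_bdry \<phi> (test_norm i))) (at_left 1)"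
    by (intro ennreal_tendsto_cmult tendsto_sum bdry_SUP_tendsto \<phi>_disc) simp
  have "bdry_SUP \<phi> (coef_ratio j) \<delta> \<le>
      ennreal (2 ^ (m + 2) * (inversion_const m * 8)) * (\<Sum>i\<in>{1..3}. bdry_SUP \<phi> (test_norm i) \<delta>)"
    if \<delta>: "1/2 < \<delta>" for \<delta>
    unfolding bdry_SUP_def[of \<phi> "coef_ratio j"]
  proof (rule SUP_least)
    fix z assume "z \<in> {z \<in> unit_disc. \<delta> < cmod (\<phi> z)}"
    then have z: "z \<in> unit_disc" "\<delta> < cmod (\<phi> z)"
      by auto
    have "coef_ratio j z \<le> ennreal (2 ^ (m + 2) * (inversion_const m * 8)) * (\<Sum>i\<in>{1..3}. test_norm i z)"
      using z \<delta> by (intro coef_ratio_le_test_norm j) auto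
    also have "\<dots> \<le> ennreal (2 ^ (m + 2) * (inversion_const m * 8)) * (\<Sum>i\<in>{1..3}. bdry_SUP \<phi> (test_norm i) \<delta>)"
      by (intro mult_left_mono sum_mono bdry_SUP_upper z) simp
    finally show "coef_ratio j z \<le> \<dots>" .
  qed
  then show "\<forall>\<^sub>F \<delta> in at_left 1. bdry_SUP \<phi> (coef_ratio j) \<delta> \<le>
      ennreal (2 ^ (m + 2) * (inversion_const m * 8)) * (\<Sum>i\<in>{1..3}. bdry_SUP \<phi> (test_norm i) \<delta>)"
    by (auto simp: eventually_at_left[of "1/2" "1::real"] intro!: exI[of _ "1/2"])
qed

text \<open>The left side of \<open>ess_norm_le_bdry_SUP\<close> is independent of \<delta>, so the
  estimate survives letting \<delta> tend to 1.\<close>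

lemma ess_norm_le_limsup:
  "ess_norm_T \<le> (\<Sum>j<3. ennreal (2 * fact (m + j) * 4 ^ (m + j)) * limsup_to_bdry \<phi> (coef_ratio j))"
proof (rule tendsto_lowerbound[OF _ _ trivial_limit_at_left_real])
  show "((\<lambda>\<delta>. \<Sum>j<3. ennreal (2 * fact (m + j) * 4 ^ (m + j)) * bdry_SUP \<phi> (coef_ratio j) \<delta>) \<longlongrightarrow>
      (\<Sum>j<3. ennreal (2 * fact (m + j) * 4 ^ (m + j)) * limsup_to_bdry \<phi> (coef_ratio j))) (at_left 1)"
    by (intro tendsto_sum ennreal_tendsto_cmult bdry_SUP_tendsto \<phi>_disc) simp
  show "\<forall>\<^sub>F \<delta> in at_left 1. ess_norm_T \<le>
      (\<Sum>j<3. ennreal (2 * fact (m + j) * 4 ^ (m + j)) * bdry_SUP \<phi> (coef_ratio j) \<delta>)"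
    using ess_norm_le_bdry_SUP by (auto simp: eventually_at_left[of 0 "1::real"] intro!: exI[of _ 0])
qed

end

section \<open>The two equivalences of the theorem\<close>

text \<open>Going around the cycle supplies the reverse inequalities,
  \<open>B \<le> b * d * A\<close> and \<open>D \<le> d * a * B\<close>.\<close>

lemma comparable_cycle:
  assumes "A \<le> ennreal a * B" "B \<le> ennreal b * D" "D \<le> ennreal d * A"
    and "0 \<le> a" "0 \<le> b" "0 \<le> d" and C: "a \<le> C" "b \<le> C" "b * d \<le> C" "d * a \<le> C" "0 < C"
  shows "comparable C A B" "comparable C B D"
proof -
  have up: "x \<le> ennreal C * y" if "x \<le> ennreal c * y" "c \<le> C" for x y c
    using that by (meson dual_order.trans ennreal_leI mult_right_mono zero_le)
  have down: "ennreal (1 / C) * x \<le> y" if "x \<le> ennreal C * y" for x y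
  proof -
    have "ennreal (1 / C) * x \<le> ennreal (1 / C) * (ennreal C * y)"
      using that by (rule mult_left_mono) simp
    also have "\<dots> = (ennreal (1 / C) * ennreal C) * y"
      by (simp only: mult.assoc)
    also have "ennreal (1 / C) * ennreal C = 1"
      using C(5) by (subst ennreal_mult[symmetric]) auto
    finally show ?thesis
      by simp
  qed
  have "B \<le> ennreal b * (ennreal d * A)"
    using assms(2,3) by (meson dual_order.trans mult_left_mono zero_le)
  then have BA: "B \<le> ennreal (b * d) * A"
    using assms(5,6) by (simp add: ennreal_mult mult.assoc)
  have "D \<le> ennreal d * (ennreal a * B)"
    using assms(1,3) by (meson dual_order.trans mult_left_mono zero_le)
  then have DB: "D \<le> ennreal (d * a) * B"
    using assms(4,6) by (simp add: ennreal_mult mult.assoc)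
  show "comparable C A B"
    unfolding comparable_def by (intro conjI down up[OF BA] up[OF assms(1)] C)
  show "comparable C B D"
    unfolding comparable_def by (intro conjI down up[OF DB] up[OF assms(2)] C)
qed

theorem theorem4p3:
  fixes m n :: nat and \<mu> :: "complex \<Rightarrow> real"
  assumes "1 \<le> n" and "m + 1 = n" and "radial_weight \<mu>"
  shows "\<exists>C>0. \<forall>\<psi>\<^sub>1 \<psi>\<^sub>2 \<phi>.
    \<psi>\<^sub>1 holomorphic_on unit_disc \<and> \<psi>\<^sub>2 holomorphic_on unit_disc \<and>
    \<phi> holomorphic_on unit_disc \<and> \<phi> ` unit_disc \<subseteq> unit_disc \<and>
    bounded_op Hinf Hinf_norm (bloch \<mu>) (bloch_norm \<mu>) (T_op m n \<psi>\<^sub>1 \<psi>\<^sub>2 \<phi>) \<longrightarrow>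
    (let A = ess_norm Hinf Hinf_norm (bloch \<mu>) (bloch_norm \<mu>) (T_op m n \<psi>\<^sub>1 \<psi>\<^sub>2 \<phi>);
         B = max
           (MAX i\<in>{m, n + 1}. limsup_to_bdry \<phi> (\<lambda>z. ennreal
              (\<mu> z * cmod (E_fun m n \<psi>\<^sub>1 \<psi>\<^sub>2 \<phi> i z) / (1 - (cmod (\<phi> z))\<^sup>2) ^ i)))
           (limsup_to_bdry \<phi> (\<lambda>z. ennreal
              (\<mu> z * cmod (\<psi>\<^sub>1 z * deriv \<phi> z + deriv \<psi>\<^sub>2 z) / (1 - (cmod (\<phi> z))\<^sup>2) ^ n)));
         D = (MAX i\<in>{1..3}. limsup_to_bdry \<phi> (\<lambda>w.
              bloch_norm \<mu> (T_op m n \<psi>\<^sub>1 \<psi>\<^sub>2 \<phi> (test_fun i (\<phi> w)))))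
     in comparable C A B \<and> comparable C B D)"
proof -
  \<comment> \<open>\<open>a\<close> adds up the three Cauchy constants, and the factor 3 in
    \<open>b\<close> comes from bounding each of three summands by their maximum. With
    \<open>d = 2\<close> the choice of \<open>C\<close> below dominates \<open>a\<close>,
    \<open>b\<close>, \<open>b * d\<close> and \<open>d * a\<close>. All depend on \<open>m\<close>
    alone, which is why they precede the choice of \<open>\<psi>\<^sub>1\<close>,
    \<open>\<psi>\<^sub>2\<close> and \<open>\<phi>\<close>.\<close>
  define a where "a = (\<Sum>j<3. 2 * fact (m + j) * 4 ^ (m + j) :: real)"
  define b where "b = 2 ^ (m + 2) * (inversion_const m * 8) * 3"
  have a: "0 \<le> a" and b: "0 \<le> b"
    by (auto simp: a_def b_def inversion_const_def intro: sum_nonneg)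
  define C where "C = 1 + 2 * a + 2 * b"
  have C: "C > 0"
    using a b by (simp add: C_def)
  have n: "n = m + 1"
    using assms(2) by simp
  show ?thesis
    unfolding n Let_def
  proof (intro exI[of _ C] conjI[OF C] allI impI)
    fix \<psi>\<^sub>1 \<psi>\<^sub>2 \<phi>
    assume "\<psi>\<^sub>1 holomorphic_on unit_disc \<and> \<psi>\<^sub>2 holomorphic_on unit_disc \<and>
      \<phi> holomorphic_on unit_disc \<and> \<phi> ` unit_disc \<subseteq> unit_disc \<and>
      bounded_op Hinf Hinf_norm (bloch \<mu>) (bloch_norm \<mu>) (T_op m (m + 1) \<psi>\<^sub>1 \<psi>\<^sub>2 \<phi>)"
    then interpret bounded_T_op m \<mu> \<psi>\<^sub>1 \<psi>\<^sub>2 \<phi>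
      using assms(3) by unfold_locales auto
    let ?B = "max
           (MAX i\<in>{m, m + 1 + 1}. limsup_to_bdry \<phi> (\<lambda>z. ennreal
              (\<mu> z * cmod (E_fun m (m + 1) \<psi>\<^sub>1 \<psi>\<^sub>2 \<phi> i z) / (1 - (cmod (\<phi> z))\<^sup>2) ^ i)))
           (limsup_to_bdry \<phi> (\<lambda>z. ennreal
              (\<mu> z * cmod (\<psi>\<^sub>1 z * deriv \<phi> z + deriv \<psi>\<^sub>2 z) / (1 - (cmod (\<phi> z))\<^sup>2) ^ (m + 1))))"
    let ?D = "MAX i\<in>{1..3}. limsup_to_bdry \<phi> (test_norm i)"
    \<comment> \<open>The index \<open>m + 2\<close> differs from \<open>m\<close>, so
      \<open>E_fun\<close> selects its second branch there; the three quotients are the ratios with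
      \<open>j = 0\<close>, \<open>j = 2\<close> and \<open>j = 1\<close>.\<close>
    have B: "?B = (MAX j\<in>{..<3}. limsup_to_bdry \<phi> (coef_ratio j))"
    proof -
      have "(\<lambda>z. ennreal (\<mu> z * cmod (E_fun m (m + 1) \<psi>\<^sub>1 \<psi>\<^sub>2 \<phi> m z) / (1 - (cmod (\<phi> z))\<^sup>2) ^ m)) = coef_ratio 0"
        "(\<lambda>z. ennreal (\<mu> z * cmod (E_fun m (m + 1) \<psi>\<^sub>1 \<psi>\<^sub>2 \<phi> (m + 1 + 1) z) /
          (1 - (cmod (\<phi> z))\<^sup>2) ^ (m + 1 + 1))) = coef_ratio 2"
        "(\<lambda>z. ennreal (\<mu> z * cmod (\<psi>\<^sub>1 z * deriv \<phi> z + deriv \<psi>\<^sub>2 z) /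
          (1 - (cmod (\<phi> z))\<^sup>2) ^ (m + 1))) = coef_ratio 1"
        by (auto simp: coef_ratio_def coef_def E_fun_def fun_eq_iff)
      note * = this
      have "{..<3::nat} = {0, 1, 2}"
        by auto
      then show ?thesis
        unfolding image_insert image_empty * by (simp add: max.commute max.left_commute)
    qed
    have "ess_norm_T \<le> (\<Sum>j<3. ennreal (2 * fact (m + j) * 4 ^ (m + j)) * ?B)"
      unfolding B
      by (rule order_trans[OF ess_norm_le_limsup]) (intro sum_mono mult_left_mono Max_ge, auto)
    also have "\<dots> = ennreal a * ?B"
      unfolding a_def sum_distrib_right[symmetric] by (subst sum_ennreal) auto
    finally have AB: "ess_norm_T \<le> ennreal a * ?B" .
    have "?B \<le> ennreal (2 ^ (m + 2) * (inversion_const m * 8)) * (\<Sum>i\<in>{1..3::nat}. ?D)"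
      unfolding B
    proof (rule Max.boundedI)
      fix x assume "x \<in> (\<lambda>j. limsup_to_bdry \<phi> (coef_ratio j)) ` {..<3}"
      then obtain j where j: "j < 3" "x = limsup_to_bdry \<phi> (coef_ratio j)"
        by auto
      show "x \<le> ennreal (2 ^ (m + 2) * (inversion_const m * 8)) * (\<Sum>i\<in>{1..3::nat}. ?D)"
        unfolding j(2) by (rule order_trans[OF limsup_coef_ratio_le[OF j(1)]])
          (intro mult_left_mono sum_mono Max_ge, auto)
    qed (auto simp: lessThan_empty_iff)
    also have "\<dots> = ennreal b * ?D"
    proof -
      have "(\<Sum>i\<in>{1..3::nat}. x) = ennreal 3 * x" for x
        by simp
      then show ?thesis
        by (simp only: b_def ennreal_mult''[of 3] zero_le_numeral) (simp only: mult.assoc)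
    qed
    finally have BD: "?B \<le> ennreal b * ?D" .
    have "?D \<le> ennreal 2 * ess_norm_T"
    proof (rule Max.boundedI)
      fix x assume "x \<in> (\<lambda>i. limsup_to_bdry \<phi> (test_norm i)) ` {1..3}"
      then show "x \<le> ennreal 2 * ess_norm_T"
        using limsup_test_norm_le_ess_norm by auto
    qed auto
    note comparable_cycle[OF AB BD this a b, of C]
    then show "comparable C ess_norm_T ?B \<and> comparable C ?B ?D"
      using a b C by (simp add: C_def)
  qed
qed

end
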